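(* Let $(Z,\mathcal O_Z)$ be an infinite, computable ringed space of "elements" satisfying the Assumption below. If every nonempty open set contains a certain subset, denote this subset by $A$ and assume $A$ is computable with infinite complement; if there is no such subset, let $A=\emptyset$. If $A$ is finite, let $B\subset Z$ be a computable subset of $Z\setminus A$ with infinite complement; if $A$ is infinite, let $B=\emptyset$. Let $e:\mathbb Z_{>0}\to Z\setminus(A\cup B)$ be a computable enumeration of $Z\setminus(A\cup B)$ and for $X\subseteq\mathbb Z_{>0}$ set $Z_X=\{e(n):n\in X\}\cup B\cup A$, with its induced ringed space structure $(Z_X,\mathcal O_{Z_X})$. Assume $(Z_X,\mathcal O_{Z_X})\le_T X$ and $(Z_X,\mathcal O_{Z_X})\le_e X$, i.e. for each open set $U$ the functions $\phi_{U,X}(f)$ deciding membership in $\mathcal F(U\cap Z_X)$ and $\psi_{U,X}(f)$ listing the elements of $\mathcal F(U\cap Z_X)$ are computable from $X$. Consider the class $\{Z_X:X\subseteq\mathbb Z_{>0}\}$ with those ringed space morphisms $Z_M\to Z_N$ which commute with the inclusion maps $i_M:Z_M\to Z$ and $i_N:Z_N\to Z$. Then: (1) there exists a ringed space morphism $i_{M,N}:Z_M\to Z_N$ (commuting with the inclusions into $Z$) if and only if $M\subset N$; (2) given $\mathcal B=Z_X$ for some $X$ and $Z_{\{i\}}\neq Z_{\{j\}}$ of which exactly one is embeddable into $\mathcal B$, one can determine which of the two is embeddable into $\mathcal B$ by checking whether $e(i)$ or $e(j)$ is contained in $\mathcal B$; (3) the class of isomorphic copies of structures of the form $Z_S$ contains,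 for every Turing degree $\mathbf d$, a structure whose isomorphism type has Turing degree $\mathbf d$, and contains a structure whose isomorphism type has no Turing degree.
   Context: Ringed space of "elements": $Z$ is a countable irreducible topological space with countably many open sets, $\mathcal O_Z$ a sheaf of rings on $Z$ such that there is a countable ring $R(Z)$ containing all $\mathcal F(U)$; for nonempty open $U\subseteq V$, $\mathcal F(V)\subseteq\mathcal F(U)$ with restriction the inclusion; and $\mathcal F(\bigcup_iU_i)=\bigcap_i\mathcal F(U_i)$ for finite collections. Induced structure on an irreducible (in the relative topology) subset $Y\subseteq Z$: for $U_Y$ open in $Y$, $\mathcal F(U_Y)=\bigcup\{\mathcal F(U): U \text{ open in } Z,\ U\supseteq U_Y\}$ with inclusions as restriction maps. Assumption: either every $Y\subseteq Z$ containing a certain fixed subset is closed and irreducible under the relative topology, or every infinite subset of $Z$ is irreducible under the relative topology. $X\le_e Y$ means one can uniformly pass from any enumeration of $Y$ to an enumeration of $X$. Ringed spaces are structures in a language with predicates for open sets, ring languages for the rings, membership predicates for $\mathcal F(U)$ and relations for restriction maps; the Turing degree of a structure is that of its atomic diagram; the Turing degree of an isomorphism type, if it exists, is the least Turing degree of a structure in it.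
   Formalization: The enumeration e is taken to be a bijection (with repetitions (1) fails), and in (3) the inclusion map to Z is part of each structure, so isomorphic copies are isomorphic over Z and the atomic diagram includes that map; without it (3) fails, e.g. for opens ∅, {a}, Z with a constant sheaf. *)

theory Defs
  imports
    "HOL-Analysis.Abstract_Topology"
    "HOL-Algebra.Subrings"
    "HOL-Algebra.QuotRing"
    "HOL-Library.Nat_Bijection"
    "HOL-Library.Countable_Set"
begin

section \<open>Relative computability\<close>

text \<open>Kleene's partial recursive functions relative to a function
  \<open>g :: nat \<Rightarrow> nat\<close>: \<open>rec_eval g p xs y\<close> says that the program \<open>p\<close> halts on
  the arguments \<open>xs\<close> with output \<open>y\<close>. Surplus arguments are ignored.\<close>

datatype prog =
    Zero | Succ | Proj nat | Query
  | Comp prog "prog list" | PrimRec prog prog | Mu prog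

inductive rec_eval :: "(nat \<Rightarrow> nat) \<Rightarrow> prog \<Rightarrow> nat list \<Rightarrow> nat \<Rightarrow> bool" for g where
  zero: "rec_eval g Zero xs 0"
| succ: "rec_eval g Succ (x # xs) (Suc x)"
| proj: "i < length xs \<Longrightarrow> rec_eval g (Proj i) xs (xs ! i)"
| query: "rec_eval g Query (x # xs) (g x)"
| comp: "\<lbrakk>length ys = length ps; \<forall>i<length ps. rec_eval g (ps ! i) xs (ys ! i);
          rec_eval g p ys z\<rbrakk> \<Longrightarrow> rec_eval g (Comp p ps) xs z"
| prim_0: "rec_eval g p xs y \<Longrightarrow> rec_eval g (PrimRec p q) (0 # xs) y"
| prim_Suc: "\<lbrakk>rec_eval g (PrimRec p q) (n # xs) y; rec_eval g q (n # y # xs) z\<rbrakk>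
          \<Longrightarrow> rec_eval g (PrimRec p q) (Suc n # xs) z"
| mu: "\<lbrakk>rec_eval g p (n # xs) 0; \<forall>m<n. \<exists>y. rec_eval g p (m # xs) (Suc y)\<rbrakk>
          \<Longrightarrow> rec_eval g (Mu p) xs n"

definition char_fun :: "nat set \<Rightarrow> nat \<Rightarrow> nat" where
  "char_fun X n = (if n \<in> X then 1 else 0)"

definition turing_le :: "nat set \<Rightarrow> nat set \<Rightarrow> bool" where
  "turing_le X Y \<longleftrightarrow> (\<exists>p. \<forall>n. rec_eval (char_fun Y) p [n] (char_fun X n))"

definition computable_set :: "nat set \<Rightarrow> bool" where
  "computable_set X \<longleftrightarrow> (\<exists>p. \<forall>n. rec_eval (\<lambda>_. 0) p [n] (char_fun X n))"

definition computable_fun_on :: "nat set \<Rightarrow> (nat \<Rightarrow> nat) \<Rightarrow> bool" where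
  "computable_fun_on D f \<longleftrightarrow> (\<exists>p. \<forall>n\<in>D. rec_eval (\<lambda>_. 0) p [n] (f n))"

text \<open>In an enumeration the value \<open>0\<close> means "no output at this step", so that the
  empty set has enumerations too.\<close>

definition enumerates :: "(nat \<Rightarrow> nat) \<Rightarrow> nat set \<Rightarrow> bool" where
  "enumerates h X \<longleftrightarrow> X = {n. \<exists>k. h k = Suc n}"

definition enum_le :: "nat set \<Rightarrow> nat set \<Rightarrow> bool" where
  "enum_le X Y \<longleftrightarrow>
     (\<exists>p. \<forall>g. enumerates g Y \<longrightarrow>
        (\<exists>h. (\<forall>k. rec_eval g p [k] (h k)) \<and> enumerates h X))"

definition turing_degree :: "nat set \<Rightarrow> nat set set" where
  "turing_degree X = {Y. turing_le X Y \<and> turing_le Y X}"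

definition turing_degrees :: "nat set set set" where
  "turing_degrees = range turing_degree"

definition degree_le :: "nat set set \<Rightarrow> nat set set \<Rightarrow> bool" where
  "degree_le d d' \<longleftrightarrow> (\<exists>X\<in>d. \<exists>Y\<in>d'. turing_le X Y)"


section \<open>Ringed spaces\<close>

definition irreducible_space :: "'a topology \<Rightarrow> bool" where
  "irreducible_space T \<longleftrightarrow> topspace T \<noteq> {} \<and>
     \<not> (\<exists>C D. closedin T C \<and> closedin T D \<and> C \<noteq> topspace T \<and> D \<noteq> topspace T
            \<and> C \<union> D = topspace T)"

text \<open>\<open>rs_restr S V W\<close> is the restriction map from the sections over \<open>V\<close> to the
  sections over \<open>W\<close>, for \<open>W \<subseteq> V\<close>.\<close>

record ('a, 'r) rspace =
  rs_top :: "'a topology"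
  rs_ring :: "'a set \<Rightarrow> 'r ring"
  rs_restr :: "'a set \<Rightarrow> 'a set \<Rightarrow> 'r \<Rightarrow> 'r"

definition ringed_space :: "('a, 'r) rspace \<Rightarrow> bool" where
  "ringed_space S \<longleftrightarrow>
     (\<forall>V. openin (rs_top S) V \<longrightarrow> ring (rs_ring S V)) \<and>
     (\<forall>V W. openin (rs_top S) V \<and> openin (rs_top S) W \<and> W \<subseteq> V \<longrightarrow>
        rs_restr S V W \<in> ring_hom (rs_ring S V) (rs_ring S W)) \<and>
     (\<forall>V. openin (rs_top S) V \<longrightarrow>
        (\<forall>s\<in>carrier (rs_ring S V). rs_restr S V V s = s)) \<and>
     (\<forall>V W Q. openin (rs_top S) V \<and> openin (rs_top S) W \<and> openin (rs_top S) Q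
          \<and> Q \<subseteq> W \<and> W \<subseteq> V \<longrightarrow>
        (\<forall>s\<in>carrier (rs_ring S V). rs_restr S W Q (rs_restr S V W s) = rs_restr S V Q s)) \<and>
     (\<forall>\<V> s. (\<forall>V\<in>\<V>. openin (rs_top S) V \<and> s V \<in> carrier (rs_ring S V)) \<and>
        (\<forall>V\<in>\<V>. \<forall>W\<in>\<V>. rs_restr S V (V \<inter> W) (s V) = rs_restr S W (V \<inter> W) (s W)) \<longrightarrow>
        (\<exists>!t. t \<in> carrier (rs_ring S (\<Union>\<V>)) \<and> (\<forall>V\<in>\<V>. rs_restr S (\<Union>\<V>) V t = s V)))"

text \<open>A morphism \<open>(f, \<phi>)\<close> from \<open>S\<close> to \<open>S'\<close> consists of a continuous map and of ring
  homomorphisms \<open>\<phi> V\<close> from the sections of \<open>S'\<close> over \<open>V\<close> to the sections of \<open>S\<close>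
  over the preimage of \<open>V\<close>.\<close>

type_synonym ('a, 'r, 'b, 's) rs_map = "('a \<Rightarrow> 'b) \<times> ('b set \<Rightarrow> 's \<Rightarrow> 'r)"

definition rs_preimage :: "('a, 'r) rspace \<Rightarrow> ('a \<Rightarrow> 'b) \<Rightarrow> 'b set \<Rightarrow> 'a set" where
  "rs_preimage S f V = {x \<in> topspace (rs_top S). f x \<in> V}"

definition rs_morphism ::
  "('a, 'r) rspace \<Rightarrow> ('b, 's) rspace \<Rightarrow> ('a, 'r, 'b, 's) rs_map \<Rightarrow> bool" where
  "rs_morphism S S' m \<longleftrightarrow>
     continuous_map (rs_top S) (rs_top S') (fst m) \<and>
     (\<forall>V. openin (rs_top S') V \<longrightarrow>
        snd m V \<in> ring_hom (rs_ring S' V) (rs_ring S (rs_preimage S (fst m) V))) \<and>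
     (\<forall>V W. openin (rs_top S') V \<and> openin (rs_top S') W \<and> W \<subseteq> V \<longrightarrow>
        (\<forall>s\<in>carrier (rs_ring S' V).
           snd m W (rs_restr S' V W s) =
           rs_restr S (rs_preimage S (fst m) V) (rs_preimage S (fst m) W) (snd m V s)))"

text \<open>The composition of \<open>m\<close> from \<open>S\<close> to \<open>S'\<close> with \<open>m'\<close> from \<open>S'\<close> to a third space.\<close>

definition rs_comp ::
  "('b, 's) rspace \<Rightarrow> ('b, 's, 'c, 't) rs_map \<Rightarrow> ('a, 'r, 'b, 's) rs_map \<Rightarrow> ('a, 'r, 'c, 't) rs_map"
  where
  "rs_comp S' m' m = (fst m' \<circ> fst m, \<lambda>W. snd m (rs_preimage S' (fst m') W) \<circ> snd m' W)"

definition rs_map_eq ::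
  "('a, 'r) rspace \<Rightarrow> ('b, 's) rspace \<Rightarrow> ('a, 'r, 'b, 's) rs_map \<Rightarrow> ('a, 'r, 'b, 's) rs_map \<Rightarrow> bool"
  where
  "rs_map_eq S S' m m' \<longleftrightarrow>
     (\<forall>x\<in>topspace (rs_top S). fst m x = fst m' x) \<and>
     (\<forall>V. openin (rs_top S') V \<longrightarrow> (\<forall>s\<in>carrier (rs_ring S' V). snd m V s = snd m' V s))"

definition rs_id :: "('a, 'r, 'a, 'r) rs_map" where
  "rs_id = (\<lambda>x. x, \<lambda>V s. s)"


section \<open>Ringed spaces of elements\<close>

text \<open>The sections over a nonempty open set \<open>V\<close> form the subring \<open>F V\<close> of \<open>R\<close> and the
  restriction maps are inclusions. Over the empty set a sheaf must have the zero ring,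
  which is realised on the element \<open>\<zero>\<close> of \<open>R\<close>; the value \<open>F {}\<close> is irrelevant.\<close>

definition element_space :: "'a topology \<Rightarrow> 'r ring \<Rightarrow> ('a set \<Rightarrow> 'r set) \<Rightarrow> ('a, 'r) rspace" where
  "element_space T R F =
     \<lparr>rs_top = T,
      rs_ring = (\<lambda>V. if V = {} then R\<lparr>carrier := {\<zero>\<^bsub>R\<^esub>}, one := \<zero>\<^bsub>R\<^esub>\<rparr> else R\<lparr>carrier := F V\<rparr>),
      rs_restr = (\<lambda>V W s. if W = {} then \<zero>\<^bsub>R\<^esub> else s)\<rparr>"

definition ringed_space_of_elements ::
  "'a topology \<Rightarrow> 'r ring \<Rightarrow> ('a set \<Rightarrow> 'r set) \<Rightarrow> bool" where
  "ringed_space_of_elements T R F \<longleftrightarrow>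
     countable (topspace T) \<and> irreducible_space T \<and> countable {V. openin T V} \<and>
     ringed_space (element_space T R F) \<and>
     ring R \<and> countable (carrier R) \<and>
     (\<forall>V. openin T V \<and> V \<noteq> {} \<longrightarrow> subring (F V) R) \<and>
     (\<forall>V W. openin T V \<and> openin T W \<and> W \<noteq> {} \<and> W \<subseteq> V \<longrightarrow> F V \<subseteq> F W) \<and>
     (\<forall>\<V>. finite \<V> \<and> \<V> \<noteq> {} \<and> (\<forall>V\<in>\<V>. openin T V \<and> V \<noteq> {}) \<longrightarrow>
        F (\<Union>\<V>) = (\<Inter>V\<in>\<V>. F V))"

text \<open>The induced structure is defined by the same formula for every subset \<open>Y\<close>; it is a
  sheaf when \<open>Y\<close> is irreducible in the relative topology.\<close>

definition induced_sections ::
  "'a topology \<Rightarrow> ('a set \<Rightarrow> 'r set) \<Rightarrow> 'a set \<Rightarrow> 'r set" where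
  "induced_sections T F V = \<Union>{F U |U. openin T U \<and> V \<subseteq> U}"

definition induced_space ::
  "'a topology \<Rightarrow> 'r ring \<Rightarrow> ('a set \<Rightarrow> 'r set) \<Rightarrow> 'a set \<Rightarrow> ('a, 'r) rspace" where
  "induced_space T R F Y = element_space (subtopology T Y) R (induced_sections T F)"

text \<open>The inclusion of the induced space on \<open>Y\<close> into the ambient space; on sections it
  is an inclusion, except into the zero ring over the empty set.\<close>

definition inclusion_map :: "'r ring \<Rightarrow> 'a set \<Rightarrow> ('a, 'r, 'a, 'r) rs_map" where
  "inclusion_map R Y = (\<lambda>x. x, \<lambda>V s. if V \<inter> Y = {} then \<zero>\<^bsub>R\<^esub> else s)"

definition inclusion_morphism ::
  "'a topology \<Rightarrow> 'r ring \<Rightarrow> ('a set \<Rightarrow> 'r set) \<Rightarrow> 'a set \<Rightarrow> 'a set \<Rightarrow> ('a, 'r, 'a, 'r) rs_map \<Rightarrow> bool"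
  where
  "inclusion_morphism T R F Y Y' m \<longleftrightarrow>
     rs_morphism (induced_space T R F Y) (induced_space T R F Y') m \<and>
     rs_map_eq (induced_space T R F Y) (element_space T R F)
       (rs_comp (induced_space T R F Y') (inclusion_map R Y') m) (inclusion_map R Y)"

definition embeddable ::
  "'a topology \<Rightarrow> 'r ring \<Rightarrow> ('a set \<Rightarrow> 'r set) \<Rightarrow> 'a set \<Rightarrow> 'a set \<Rightarrow> bool" where
  "embeddable T R F Y Y' \<longleftrightarrow>
     (\<exists>m. inclusion_morphism T R F Y Y' m \<and>
          embedding_map (rs_top (induced_space T R F Y)) (rs_top (induced_space T R F Y')) (fst m))"


section \<open>Ringed spaces as countable structures\<close>

text \<open>The language of ringed spaces over a fixed space \<open>Z\<close> whose open sets are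
  \<open>U 0, U 1, \<dots>\<close>. It is many-sorted: there is a sort of points and, for every \<open>u\<close>, a sort for
  the sections over (the preimage of) \<open>U u\<close>, which carries the language of rings. The relation
  symbol \<open>st_res v u\<close> is for the graph of the restriction map and belongs to the language when
  \<open>U u \<subseteq> U v\<close>; otherwise it is interpreted as empty. Objects are considered together
  with their map to \<open>Z\<close>, so the language also has its graph on points and on sections
  (\<open>st_to\<close> and \<open>st_from u\<close>). All sorts of a structure are sets of natural numbers.\<close>

record rs_structure =
  st_points :: "nat set"
  st_open :: "nat \<Rightarrow> nat set"
  st_ring :: "nat \<Rightarrow> nat ring"
  st_res :: "nat \<Rightarrow> nat \<Rightarrow> (nat \<times> nat) set"
  st_to :: "(nat \<times> nat) set"
  st_from :: "nat \<Rightarrow> (nat \<times> nat) set"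

definition structure_over ::
  "(nat, nat) rspace \<Rightarrow> (nat \<Rightarrow> nat set) \<Rightarrow> (nat, nat) rspace \<Rightarrow> (nat, nat, nat, nat) rs_map
   \<Rightarrow> rs_structure" where
  "structure_over Z U S m =
     (let P = (\<lambda>u. rs_preimage S (fst m) (U u)) in
      \<lparr>st_points = topspace (rs_top S),
       st_open = P,
       st_ring = (\<lambda>u. rs_ring S (P u)),
       st_res = (\<lambda>v u. if U u \<subseteq> U v
                       then {(s, rs_restr S (P v) (P u) s) |s. s \<in> carrier (rs_ring S (P v))}
                       else {}),
       st_to = {(x, fst m x) |x. x \<in> topspace (rs_top S)},
       st_from = (\<lambda>u. {(s, snd m (U u) s) |s. s \<in> carrier (rs_ring Z (U u))})\<rparr>)"

definition structure_iso :: "rs_structure \<Rightarrow> rs_structure \<Rightarrow> bool" where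
  "structure_iso \<A> \<B> \<longleftrightarrow>
     (\<exists>h k. bij_betw h (st_points \<A>) (st_points \<B>) \<and>
        (\<forall>u. st_open \<B> u = h ` st_open \<A> u) \<and>
        (\<forall>u. k u \<in> ring_iso (st_ring \<A> u) (st_ring \<B> u) \<and>
             k u \<zero>\<^bsub>st_ring \<A> u\<^esub> = \<zero>\<^bsub>st_ring \<B> u\<^esub>) \<and>
        (\<forall>v u. st_res \<B> v u = map_prod (k v) (k u) ` st_res \<A> v u) \<and>
        st_to \<B> = map_prod h id ` st_to \<A> \<and>
        (\<forall>u. st_from \<B> u = map_prod id (k u) ` st_from \<A> u))"

text \<open>The codes of the true atomic sentences with natural-number parameters; the negated
  atomic sentences are the complement, so this set has the Turing degree of the atomic
  diagram.\<close>

definition atomic_diagram :: "rs_structure \<Rightarrow> nat set" where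
  "atomic_diagram \<A> =
     {list_encode [0, x] |x. x \<in> st_points \<A>} \<union>
     {list_encode [1, u, x] |u x. x \<in> st_open \<A> u} \<union>
     {list_encode [2, u, s] |u s. s \<in> carrier (st_ring \<A> u)} \<union>
     {list_encode [3, u, s, t, s \<oplus>\<^bsub>st_ring \<A> u\<^esub> t] |u s t.
        s \<in> carrier (st_ring \<A> u) \<and> t \<in> carrier (st_ring \<A> u)} \<union>
     {list_encode [4, u, s, t, s \<otimes>\<^bsub>st_ring \<A> u\<^esub> t] |u s t.
        s \<in> carrier (st_ring \<A> u) \<and> t \<in> carrier (st_ring \<A> u)} \<union>
     {list_encode [5, u, \<zero>\<^bsub>st_ring \<A> u\<^esub>] |u. True} \<union>
     {list_encode [6, u, \<one>\<^bsub>st_ring \<A> u\<^esub>] |u. True} \<union>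
     {list_encode [7, v, u, s, t] |v u s t. (s, t) \<in> st_res \<A> v u} \<union>
     {list_encode [8, x, z] |x z. (x, z) \<in> st_to \<A>} \<union>
     {list_encode [9, u, r, s] |u r s. (r, s) \<in> st_from \<A> u}"

definition computable_structure :: "rs_structure \<Rightarrow> bool" where
  "computable_structure \<A> \<longleftrightarrow> computable_set (atomic_diagram \<A>)"

text \<open>\<open>d\<close> is the least Turing degree of a structure in the isomorphism type of \<open>\<A>\<close>.\<close>

definition iso_type_has_degree :: "rs_structure \<Rightarrow> nat set set \<Rightarrow> bool" where
  "iso_type_has_degree \<A> d \<longleftrightarrow>
     (\<exists>\<B>. structure_iso \<A> \<B> \<and> turing_degree (atomic_diagram \<B>) = d) \<and>
     (\<forall>\<B>. structure_iso \<A> \<B> \<longrightarrow> degree_le d (turing_degree (atomic_diagram \<B>)))"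

definition ambient_structure ::
  "nat topology \<Rightarrow> nat ring \<Rightarrow> (nat set \<Rightarrow> nat set) \<Rightarrow> (nat \<Rightarrow> nat set) \<Rightarrow> rs_structure" where
  "ambient_structure T R F U =
     structure_over (element_space T R F) U (element_space T R F) rs_id"

definition induced_structure ::
  "nat topology \<Rightarrow> nat ring \<Rightarrow> (nat set \<Rightarrow> nat set) \<Rightarrow> (nat \<Rightarrow> nat set) \<Rightarrow> nat set \<Rightarrow> rs_structure"
  where
  "induced_structure T R F U Y =
     structure_over (element_space T R F) U (induced_space T R F Y) (inclusion_map R Y)"

text \<open>The membership relation "\<open>f\<close> is a section over \<open>U u \<inter> Y\<close>", uniformly in the index
  \<open>u\<close> of the open set.\<close>

definition section_set ::
  "nat topology \<Rightarrow> nat ring \<Rightarrow> (nat set \<Rightarrow> nat set) \<Rightarrow> (nat \<Rightarrow> nat set) \<Rightarrow> nat set \<Rightarrow> nat set" where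
  "section_set T R F U Y =
     {prod_encode (u, f) |u f. f \<in> carrier (rs_ring (induced_space T R F Y) (U u \<inter> Y))}"

definition coded_subset :: "nat set \<Rightarrow> nat set \<Rightarrow> (nat \<Rightarrow> nat) \<Rightarrow> nat set \<Rightarrow> nat set" where
  "coded_subset A B e X = {e n |n. n \<in> X} \<union> B \<union> A"

end

theory Submission
  imports Defs "HOL-Library.Countable" "HOL-Analysis.Continuum_Not_Denumerable"
begin

text \<open>The points of a copy of \<open>Z\<^sub>S\<close> are mapped to \<open>Z\<close>, so the diagram of a copy enumerates \<open>S\<close>.
  Conversely, from an enumeration of \<open>S\<close> one computes a copy, by attaching to every point and
  every section the first stage at which it is enumerated, provided that it can be decided which
  open sets miss \<open>Z\<^sub>S\<close>. For \<open>S\<close> coding \<open>X\<close> together with its complement, the least degree of a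
  copy is therefore the degree of \<open>X\<close>.

  If the isomorphism type of \<open>Z\<^sub>S\<close> has a degree, then the diagram \<open>D\<close> of some copy is computable
  from every enumeration of \<open>S\<close>. By a generic enumeration, \<open>D\<close> is then obtained from \<open>S\<close> by one
  of countably many operators that are monotone in \<open>S\<close>. On sets for which the operator yields a
  total function monotonicity makes the value constant along inclusions, and \<open>D\<close> determines \<open>S\<close>;
  so the sets \<open>S\<close> belonging to one operator form an antichain. An uncountable chain of sets meeting
  all relevant open sets thus contains an \<open>S\<close> whose isomorphism type has no degree.\<close>

section \<open>Properties of relative computations\<close>

text \<open>The obstacle is deciding emptiness. In a nontrivial \<open>R\<close>, the unit of the
  ring over an open set equals zero exactly when that set misses Z_S. Hence every copy decides this
  question, whereas an enumeration of \<open>S\<close> directly confirms only that a set is met. Two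
  devices answer it. When \<open>S\<close> codes \<open>X\<close> and its complement,
  \<open>X\<close> computes an enumeration of \<open>S\<close> that in turn decides
  \<open>S\<close>, and \<open>le_T\<close> then tells whether \<open>\<one>\<close> is a section.
  For a type without a degree, \<open>S\<close> contains a fixed transversal of the open sets not
  met by \<open>A\<close> or \<open>B\<close>, so emptiness in Z_S is emptiness in Z. The
  transversal can be spread out because nonempty open sets are infinite when \<open>A\<close> is
  empty; a nonempty \<open>A\<close> meets them by itself. The program given by \<open>le_e\<close>
  may depend on \<open>X\<close>, so no single operator is available for all \<open>S\<close>. The
  cardinality argument tolerates this: it uses only that there are countably many pairs of a program
  and a finite prefix. The uncountable chain consists of Dedekind cuts.\<close>

lemma rec_eval_deterministic:
  "rec_eval g p xs y \<Longrightarrow> rec_eval g p xs z \<Longrightarrow> y = z"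
proof (induction arbitrary: z rule: rec_eval.induct)
  case (zero xs)
  then show ?case by cases auto
next
  case (succ x xs)
  then show ?case by cases auto
next
  case (proj i xs)
  from proj(2) show ?case by cases auto
next
  case (query x xs)
  then show ?case by cases auto
next
  case (comp ys ps xs p w)
  from comp.prems show ?case
  proof cases
    case (comp ys')
    have "ys = ys'"
      by (rule nth_equalityI) (use comp comp.hyps comp.IH in \<open>auto\<close>)
    then show ?thesis using comp comp.IH by blast
  qed
next
  case (prim_0 p xs y q)
  from prim_0.prems show ?case by cases (use prim_0.IH in auto)
next
  case (prim_Suc p q n xs y w)
  from prim_Suc.prems show ?case by cases (use prim_Suc.IH in auto)
next
  case (mu p n xs)
  from mu.prems show ?case
  proof cases
    case mu': mu
    show ?thesis
    proof (cases n z rule: linorder_cases)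
      case less
      then obtain y where "rec_eval g p (n # xs) (Suc y)" using mu' by blast
      then show ?thesis using mu.IH by blast
    next
      case greater
      then show ?thesis using mu' mu.IH by blast
    qed
  qed
qed

text \<open>The use principle: a halting computation is a finite derivation, so only finitely many
  oracle values enter it. This lets a finite prefix of an enumeration force an output.\<close>

lemma rec_eval_use:
  "rec_eval g p xs y \<Longrightarrow> \<exists>m. \<forall>h. (\<forall>i<m. h i = g i) \<longrightarrow> rec_eval h p xs y"
proof (induction rule: rec_eval.induct)
  case (query x xs)
  have "\<forall>h. (\<forall>i<Suc x. h i = g i) \<longrightarrow> rec_eval h Query (x # xs) (g x)"
    by (metis lessI rec_eval.query)
  then show ?case by blast
next
  case (comp ys ps xs p z)
  obtain m0 where m0: "\<forall>h. (\<forall>i<m0. h i = g i) \<longrightarrow> rec_eval h p ys z" using comp by blast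
  obtain m where m: "\<forall>i<length ps. \<forall>h. (\<forall>j<m i. h j = g j) \<longrightarrow> rec_eval h (ps ! i) xs (ys ! i)"
    using comp.IH(1) by metis
  \<comment> \<open>Any upper bound will do, and the sum dominates all of the finitely many uses at
    once.\<close>
  define M where "M = m0 + (\<Sum>i<length ps. m i)"
  have le: "m i \<le> M" if "i < length ps" for i
    using member_le_sum[of i "{..<length ps}" m] that by (auto simp: M_def)
  have "rec_eval h (Comp p ps) xs z" if h: "\<forall>i<M. h i = g i" for h
  proof (rule rec_eval.comp)
    show "\<forall>i<length ps. rec_eval h (ps ! i) xs (ys ! i)"
      using m le h by (meson order_less_le_trans)
    show "rec_eval h p ys z" using m0 h by (auto simp: M_def)
  qed (use comp in auto)
  then show ?case by blast
next
  case (prim_Suc p q n xs y z)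
  then obtain m1 m2 where
    "\<forall>h. (\<forall>i<m1. h i = g i) \<longrightarrow> rec_eval h (PrimRec p q) (n # xs) y"
    "\<forall>h. (\<forall>i<m2. h i = g i) \<longrightarrow> rec_eval h q (n # y # xs) z" by blast
  then have "\<forall>h. (\<forall>i<max m1 m2. h i = g i) \<longrightarrow> rec_eval h (PrimRec p q) (Suc n # xs) z"
    by (meson less_max_iff_disj rec_eval.prim_Suc)
  then show ?case by blast
next
  case (mu p n xs)
  then obtain m0 where m0: "\<forall>h. (\<forall>i<m0. h i = g i) \<longrightarrow> rec_eval h p (n # xs) 0" by blast
  have "\<forall>j<n. \<exists>y m. \<forall>h. (\<forall>i<m. h i = g i) \<longrightarrow> rec_eval h p (j # xs) (Suc y)"
    using mu.IH by blast
  then obtain y m where m: "\<forall>j<n. \<forall>h. (\<forall>i<m j. h i = g i) \<longrightarrow> rec_eval h p (j # xs) (Suc (y j))"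
    by metis
  define M where "M = m0 + (\<Sum>j<n. m j)"
  have le: "m j \<le> M" if "j < n" for j
    using member_le_sum[of j "{..<n}" m] that by (auto simp: M_def)
  have "rec_eval h (Mu p) xs n" if h: "\<forall>i<M. h i = g i" for h
  proof (rule rec_eval.mu)
    show "rec_eval h p (n # xs) 0" using m0 h by (auto simp: M_def)
    show "\<forall>j<n. \<exists>y. rec_eval h p (j # xs) (Suc y)"
      using m le h by (meson order_less_le_trans)
  qed
  then show ?case by blast
qed (auto intro: rec_eval.intros)

text \<open>\<open>Query\<close> reads only the head of its argument list, whereas \<open>q\<close>
  will be assumed correct on singletons only; hence the \<open>Proj 0\<close>.\<close>

fun subst_query :: "prog \<Rightarrow> prog \<Rightarrow> prog" where
  "subst_query q Query = Comp q [Proj 0]"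
| "subst_query q (Comp p ps) = Comp (subst_query q p) (map (subst_query q) ps)"
| "subst_query q (PrimRec p p') = PrimRec (subst_query q p) (subst_query q p')"
| "subst_query q (Mu p) = Mu (subst_query q p)"
| "subst_query q Zero = Zero"
| "subst_query q Succ = Succ"
| "subst_query q (Proj i) = Proj i"

lemma rec_eval_Comp1:
  assumes "rec_eval g q xs y" "rec_eval g p [y] z"
  shows "rec_eval g (Comp p [q]) xs z"
  by (rule rec_eval.comp[of "[y]"]) (use assms in auto)

lemma rec_eval_Proj_0: "rec_eval g (Proj 0) (x # xs) x"
  using rec_eval.proj[of 0 "x # xs"] by simp

lemma rec_eval_subst_query:
  assumes q: "\<And>x. rec_eval g q [x] (g' x)"
  shows "rec_eval g' p xs y \<Longrightarrow> rec_eval g (subst_query q p) xs y"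
proof (induction rule: rec_eval.induct)
  case (query x xs)
  then show ?case by (auto intro: rec_eval_Comp1[OF rec_eval_Proj_0 q])
next
  case (comp ys ps xs p z)
  then show ?case by (auto intro!: rec_eval.comp[of ys])
qed (auto intro: rec_eval.intros)


section \<open>Closure properties of computability\<close>

text \<open>Primitive recursion and minimisation act on the head of an argument list, so the basic
  closure properties are obtained for lists of fixed length and then transferred to unary functions
  of pair codes.\<close>

definition computable_list_in :: "(nat \<Rightarrow> nat) set \<Rightarrow> nat \<Rightarrow> (nat list \<Rightarrow> nat) \<Rightarrow> bool" where
  "computable_list_in G k f \<longleftrightarrow>
     (\<exists>p. \<forall>g\<in>G. \<forall>xs. length xs = k \<longrightarrow> rec_eval g p xs (f xs))"

text \<open>One program has to work for all oracles in \<open>G\<close>. Functions of several arguments are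
  treated as functions of a code built with \<open>prod_encode\<close>, so that a variable bound by a
  search becomes the first component of the argument.\<close>

definition computable_in :: "(nat \<Rightarrow> nat) set \<Rightarrow> (nat \<Rightarrow> nat) \<Rightarrow> bool" where
  "computable_in G f \<longleftrightarrow> (\<exists>p. \<forall>g\<in>G. \<forall>n. rec_eval g p [n] (f n))"

definition decidable_in :: "(nat \<Rightarrow> nat) set \<Rightarrow> (nat \<Rightarrow> bool) \<Rightarrow> bool" where
  "decidable_in G P \<longleftrightarrow> computable_in G (\<lambda>n. of_bool (P n))"

definition pfst :: "nat \<Rightarrow> nat" where "pfst n = fst (prod_decode n)"
definition psnd :: "nat \<Rightarrow> nat" where "psnd n = snd (prod_decode n)"

lemma pfst_prod_encode [simp]: "pfst (prod_encode (a, b)) = a"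
  by (simp add: pfst_def)

lemma psnd_prod_encode [simp]: "psnd (prod_encode (a, b)) = b"
  by (simp add: psnd_def)

lemma prod_encode_pfst_psnd [simp]: "prod_encode (pfst n, psnd n) = n"
  by (simp add: pfst_def psnd_def)

lemma computable_in_iff_list: "computable_in G f \<longleftrightarrow> computable_list_in G 1 (\<lambda>xs. f (xs ! 0))"
  by (fastforce simp: computable_in_def computable_list_in_def length_Suc_conv)

lemma computable_list_proj: "i < k \<Longrightarrow> computable_list_in G k (\<lambda>xs. xs ! i)"
  by (auto simp: computable_list_in_def intro!: exI[of _ "Proj i"] rec_eval.proj)

lemma computable_list_zero: "computable_list_in G k (\<lambda>_. 0)"
  by (auto simp: computable_list_in_def intro!: exI[of _ Zero] rec_eval.zero)

lemma computable_list_comp: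
  assumes "computable_list_in G (length fs) F"
    and "\<And>f. f \<in> set fs \<Longrightarrow> computable_list_in G k f"
  shows "computable_list_in G k (\<lambda>xs. F (map (\<lambda>f. f xs) fs))"
proof -
  obtain p where p: "\<forall>g\<in>G. \<forall>xs. length xs = length fs \<longrightarrow> rec_eval g p xs (F xs)"
    using assms(1) by (auto simp: computable_list_in_def)
  obtain q where q: "\<And>f. f \<in> set fs \<Longrightarrow> \<forall>g\<in>G. \<forall>xs. length xs = k \<longrightarrow> rec_eval g (q f) xs (f xs)"
    using assms(2) unfolding computable_list_in_def by metis
  have "rec_eval g (Comp p (map q fs)) xs (F (map (\<lambda>f. f xs) fs))"
    if "g \<in> G" "length xs = k" for g xs
    by (rule rec_eval.comp[of "map (\<lambda>f. f xs) fs"]) (use that p q in auto)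
  then show ?thesis by (auto simp: computable_list_in_def)
qed

lemma computable_list_comp1:
  assumes "computable_list_in G 1 (\<lambda>ys. F (ys ! 0))" "computable_list_in G k f"
  shows "computable_list_in G k (\<lambda>xs. F (f xs))"
  using computable_list_comp[of G "[f]" "\<lambda>ys. F (ys ! 0)"] assms by simp

lemma computable_list_comp2:
  assumes "computable_list_in G 2 (\<lambda>ys. F (ys ! 0) (ys ! 1))"
    and "computable_list_in G k f1" "computable_list_in G k f2"
  shows "computable_list_in G k (\<lambda>xs. F (f1 xs) (f2 xs))"
  using computable_list_comp[of G "[f1, f2]" "\<lambda>ys. F (ys ! 0) (ys ! 1)"] assms
  by (auto simp: numeral_2_eq_2)

lemma computable_list_comp3:
  assumes "computable_list_in G 3 (\<lambda>ys. F (ys ! 0) (ys ! 1) (ys ! 2))"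
    and "computable_list_in G k f1" "computable_list_in G k f2" "computable_list_in G k f3"
  shows "computable_list_in G k (\<lambda>xs. F (f1 xs) (f2 xs) (f3 xs))"
  using computable_list_comp[of G "[f1, f2, f3]" "\<lambda>ys. F (ys ! 0) (ys ! 1) (ys ! 2)"] assms
  by (auto simp: numeral_3_eq_3 numeral_2_eq_2)

lemma computable_list_Suc:
  assumes "computable_list_in G k f"
  shows "computable_list_in G k (\<lambda>xs. Suc (f xs))"
proof (rule computable_list_comp1[OF _ assms])
  show "computable_list_in G 1 (\<lambda>ys. Suc (ys ! 0))"
    by (auto simp: computable_list_in_def length_Suc_conv intro!: exI[of _ Succ] rec_eval.succ)
qed

lemma computable_list_rec_nat:
  assumes "computable_list_in G 1 (\<lambda>xs. f (xs ! 0))"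
    and "computable_list_in G 3 (\<lambda>xs. h (xs ! 0) (xs ! 1) (xs ! 2))"
  shows "computable_list_in G 2 (\<lambda>xs. rec_nat (f (xs ! 1)) (\<lambda>n y. h n y (xs ! 1)) (xs ! 0))"
proof -
  obtain p q where p: "\<And>g x. g \<in> G \<Longrightarrow> rec_eval g p [x] (f x)"
    and q: "\<And>g n y x. g \<in> G \<Longrightarrow> rec_eval g q [n, y, x] (h n y x)"
    using assms unfolding computable_list_in_def
    by (metis One_nat_def length_Cons list.size(3) nth_Cons_0 nth_Cons_Suc numeral_2_eq_2
        numeral_3_eq_3)
  have "rec_eval g (PrimRec p q) [n, x] (rec_nat (f x) (\<lambda>n y. h n y x) n)" if "g \<in> G" for g n x
    by (induction n) (auto intro: rec_eval.intros p q that)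
  then show ?thesis
    by (fastforce simp: computable_list_in_def numeral_2_eq_2 length_Suc_conv)
qed

lemma computable_list_Least:
  assumes "computable_list_in G 2 (\<lambda>xs. F (xs ! 0) (xs ! 1))" and "\<And>x. \<exists>n. F n x = 0"
  shows "computable_list_in G 1 (\<lambda>xs. LEAST n. F n (xs ! 0) = 0)"
proof -
  obtain p where p: "\<And>g n x. g \<in> G \<Longrightarrow> rec_eval g p [n, x] (F n x)"
    using assms(1) unfolding computable_list_in_def
    by (metis One_nat_def length_Cons list.size(3) nth_Cons_0 nth_Cons_Suc numeral_2_eq_2)
  have "rec_eval g (Mu p) [x] (LEAST n. F n x = 0)" if "g \<in> G" for g x
  proof (rule rec_eval.mu)
    show "rec_eval g p [LEAST n. F n x = 0, x] 0"
      using p[OF that, of "LEAST n. F n x = 0" x] LeastI_ex[OF assms(2)[of x]] by simp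
    show "\<forall>m<LEAST n. F n x = 0. \<exists>y. rec_eval g p [m, x] (Suc y)"
      using p[OF that, of _ x] not_less_Least by (metis not0_implies_Suc)
  qed
  then show ?thesis by (fastforce simp: computable_list_in_def length_Suc_conv)
qed

text \<open>Definition by cases as a recursion that discards its previous value: the base case sees
  \<open>[a, b]\<close> and picks \<open>b\<close>, a step sees \<open>[n, y, a, b]\<close> and
  picks \<open>a\<close>.\<close>

lemma rec_eval_cond:
  "rec_eval g (PrimRec (Proj 1) (Proj 2)) [c, a, b] (if c = 0 then b else a)"
proof (induction c)
  case 0
  show ?case using rec_eval.prim_0[OF rec_eval.proj[of 1 "[a, b]"]] by simp
next
  case (Suc c)
  show ?case using rec_eval.prim_Suc[OF Suc rec_eval.proj[of 2]] by simp
qed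

lemma computable_list_cond:
  assumes "computable_list_in G k c" "computable_list_in G k f1" "computable_list_in G k f2"
  shows "computable_list_in G k (\<lambda>xs. if c xs = 0 then f2 xs else f1 xs)"
proof (rule computable_list_comp3[OF _ assms])
  have "rec_eval g (PrimRec (Proj 1) (Proj 2)) ys (if ys ! 0 = 0 then ys ! 2 else ys ! 1)"
    if ys: "length ys = 3" for g ys
  proof -
    obtain a b c where "ys = [a, b, c]"
      using ys by (auto simp: numeral_3_eq_3 length_Suc_conv)
    then show ?thesis using rec_eval_cond[of g a b c] by (simp split: if_splits)
  qed
  then show "computable_list_in G 3 (\<lambda>ys. if ys ! 0 = 0 then ys ! 2 else ys ! 1)"
    by (auto simp only: computable_list_in_def)
qed

lemma computable_list_add:
  assumes "computable_list_in G k f1" "computable_list_in G k f2"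
  shows "computable_list_in G k (\<lambda>xs. f1 xs + f2 xs)"
proof (rule computable_list_comp2[OF _ assms])
  have "rec_nat m (\<lambda>_ y. Suc y) n = n + m" for n m :: nat
    by (induction n) auto
  then show "computable_list_in G 2 (\<lambda>ys. ys ! 0 + ys ! 1)"
    using computable_list_rec_nat[of G "\<lambda>x. x" "\<lambda>n y x. Suc y"]
    by (simp add: computable_list_proj computable_list_Suc)
qed

lemma computable_list_pred:
  assumes "computable_list_in G k f"
  shows "computable_list_in G k (\<lambda>xs. f xs - 1)"
proof (rule computable_list_comp1[OF _ assms])
  have "rec_nat 0 (\<lambda>n y. n) n = n - 1" for n :: nat
    by (induction n) auto
  then have "computable_list_in G 2 (\<lambda>ys. ys ! 0 - 1)"
    using computable_list_rec_nat[of G "\<lambda>x. 0" "\<lambda>n y x. n"]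
    by (simp add: computable_list_proj computable_list_zero)
  from computable_list_comp2[where F="\<lambda>x y. x - 1", OF this computable_list_proj computable_list_proj]
  show "computable_list_in G 1 (\<lambda>ys. ys ! 0 - 1)"
    by simp
qed

lemma computable_list_diff:
  assumes "computable_list_in G k f1" "computable_list_in G k f2"
  shows "computable_list_in G k (\<lambda>xs. f1 xs - f2 xs)"
\<comment> \<open>The recursion runs over the subtrahend, which therefore has to come first.\<close>
proof (rule computable_list_comp2[where F="\<lambda>x y. y - x", OF _ assms(2,1)])
  have "rec_nat m (\<lambda>_ y. y - 1) n = m - n" for n m :: nat
    by (induction n) auto
  then show "computable_list_in G 2 (\<lambda>ys. ys ! 1 - ys ! 0)"
    using computable_list_rec_nat[of G "\<lambda>x. x" "\<lambda>n y x. y - 1"]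
      computable_list_pred[OF computable_list_proj[of 1 3]]
    by (simp add: computable_list_proj)
qed

lemma computable_list_triangle:
  assumes "computable_list_in G k f"
  shows "computable_list_in G k (\<lambda>xs. triangle (f xs))"
proof (rule computable_list_comp1[OF _ assms])
  have "rec_nat 0 (\<lambda>n y. y + Suc n) n = triangle n" for n :: nat
    by (induction n) auto
  then have "computable_list_in G 2 (\<lambda>ys. triangle (ys ! 0))"
    using computable_list_rec_nat[of G "\<lambda>x. 0" "\<lambda>n y x. y + Suc n"]
    by (simp only: computable_list_proj computable_list_zero computable_list_Suc
        computable_list_add)
  from computable_list_comp2[where F="\<lambda>x y. triangle x",
      OF this computable_list_proj computable_list_proj]
  show "computable_list_in G 1 (\<lambda>ys. triangle (ys ! 0))"
    by simp
qed

lemma computable_list_prod_encode: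
  assumes "computable_list_in G k f1" "computable_list_in G k f2"
  shows "computable_list_in G k (\<lambda>xs. prod_encode (f1 xs, f2 xs))"
  using assms by (simp add: prod_encode_def computable_list_add computable_list_triangle)

text \<open>The code of \<open>(a, b)\<close> is \<open>triangle (a + b) + a\<close>, which lies
  below \<open>triangle (Suc (a + b))\<close>. So \<open>t z\<close> recovers \<open>a + b\<close>
  as the least \<open>s\<close> with \<open>z < triangle (Suc s)\<close>; truncated subtraction
  turns this inequality into a search for a zero.\<close>

lemma pfst_psnd_triangle:
  defines "t \<equiv> \<lambda>z. LEAST s. Suc z - triangle (Suc s) = 0"
  shows "pfst z = z - triangle (t z)" "psnd z = t z - pfst z"
proof -
  obtain a b where z: "z = prod_encode (a, b)"
    by (metis prod_encode_pfst_psnd)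
  have mono: "triangle m \<le> triangle n" if "m \<le> n" for m n
    using lift_Suc_mono_le[of triangle m n] that by simp
  have "t z = a + b"
    unfolding t_def
  proof (rule Least_equality)
    show "Suc z - triangle (Suc (a + b)) = 0"
      by (simp add: z prod_encode_def)
    show "a + b \<le> s" if "Suc z - triangle (Suc s) = 0" for s
    proof (rule ccontr)
      assume "\<not> a + b \<le> s"
      then have "triangle (Suc s) \<le> triangle (a + b)" by (intro mono) simp
      then show False using that by (simp add: z prod_encode_def)
    qed
  qed
  then show "pfst z = z - triangle (t z)" "psnd z = t z - pfst z"
    by (simp_all add: z) (simp add: prod_encode_def)
qed

lemma computable_list_triangle_root:
  "computable_list_in G 1 (\<lambda>xs. LEAST s. Suc (xs ! 0) - triangle (Suc s) = 0)"
proof (rule computable_list_Least[where F="\<lambda>s z. Suc z - triangle (Suc s)"])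
  show "computable_list_in G 2 (\<lambda>xs. Suc (xs ! 1) - triangle (Suc (xs ! 0)))"
    by (intro computable_list_diff computable_list_Suc computable_list_triangle
        computable_list_proj) auto
  have "n \<le> triangle n" for n by (induction n) auto
  then show "\<exists>s. Suc z - triangle (Suc s) = 0" for z
    by (metis diff_is_0_eq)
qed

section \<open>Closure properties for functions and predicates of one coded argument\<close>

named_theorems computability

lemma computable_in_compose:
  "computable_in G F \<Longrightarrow> computable_in G f \<Longrightarrow> computable_in G (\<lambda>z. F (f z))"
  using computable_list_comp1[of G F] by (simp add: computable_in_iff_list)

lemma computable_in_pfst_base: "computable_in G pfst"
  unfolding computable_in_iff_list pfst_psnd_triangle(1)
  by (intro computable_list_diff computable_list_triangle computable_list_triangle_root
      computable_list_proj) simp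

lemma computable_in_psnd_base: "computable_in G psnd"
  unfolding computable_in_iff_list pfst_psnd_triangle(2)
  by (intro computable_list_diff computable_list_triangle_root
      computable_in_pfst_base[unfolded computable_in_iff_list])

lemma computable_in_pfst [computability]:
  "computable_in G f \<Longrightarrow> computable_in G (\<lambda>z. pfst (f z))"
  by (rule computable_in_compose[OF computable_in_pfst_base])

lemma computable_in_psnd [computability]:
  "computable_in G f \<Longrightarrow> computable_in G (\<lambda>z. psnd (f z))"
  by (rule computable_in_compose[OF computable_in_psnd_base])

lemma computable_in_id [computability]: "computable_in G (\<lambda>z. z)"
  by (simp add: computable_in_iff_list computable_list_proj)

lemma computable_in_Suc [computability]:
  "computable_in G f \<Longrightarrow> computable_in G (\<lambda>z. Suc (f z))"
  by (simp add: computable_in_iff_list computable_list_Suc)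

lemma computable_in_const [computability]: "computable_in G (\<lambda>z. c)"
  by (induction c)
    (auto simp: computable_in_iff_list computable_list_zero intro: computable_list_Suc)

lemma computable_in_diff [computability]:
  "computable_in G f \<Longrightarrow> computable_in G f' \<Longrightarrow> computable_in G (\<lambda>z. f z - f' z)"
  by (simp add: computable_in_iff_list computable_list_diff)

lemma computable_in_prod_encode [computability]:
  "computable_in G f \<Longrightarrow> computable_in G f' \<Longrightarrow> computable_in G (\<lambda>z. prod_encode (f z, f' z))"
  by (simp add: computable_in_iff_list computable_list_prod_encode)

lemma computable_in_list_encode_Cons [computability]:
  "computable_in G f \<Longrightarrow> computable_in G (\<lambda>z. list_encode (l z)) \<Longrightarrow>
   computable_in G (\<lambda>z. list_encode (f z # l z))"
  by (simp add: computability)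

lemma computable_in_compose2:
  "computable_in G (\<lambda>z. F (pfst z) (psnd z)) \<Longrightarrow> computable_in G f \<Longrightarrow> computable_in G f' \<Longrightarrow>
   computable_in G (\<lambda>z. F (f z) (f' z))"
  using computable_in_compose[of G "\<lambda>z. F (pfst z) (psnd z)" "\<lambda>z. prod_encode (f z, f' z)"]
  by (simp add: computability)

lemma computable_in_if [computability]:
  assumes "decidable_in G P" "computable_in G f" "computable_in G f'"
  shows "computable_in G (\<lambda>z. if P z then f z else f' z)"
proof -
  have "computable_in G (\<lambda>z. if (of_bool (P z) :: nat) = 0 then f' z else f z)"
    using assms computable_list_cond[of G 1 "\<lambda>xs. of_bool (P (xs ! 0))"]
    by (simp add: computable_in_iff_list decidable_in_def)
  then show ?thesis by (rule back_subst[where P="computable_in G"]) auto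
qed

lemma decidable_in_compose:
  "decidable_in G P \<Longrightarrow> computable_in G f \<Longrightarrow> decidable_in G (\<lambda>z. P (f z))"
  unfolding decidable_in_def by (rule computable_in_compose)

lemma decidable_in_compose2:
  "decidable_in G (\<lambda>z. P (pfst z) (psnd z)) \<Longrightarrow> computable_in G f \<Longrightarrow> computable_in G f' \<Longrightarrow>
   decidable_in G (\<lambda>z. P (f z) (f' z))"
  unfolding decidable_in_def by (rule computable_in_compose2)

lemma decidable_in_compose3:
  assumes "decidable_in G (\<lambda>z. P (pfst z) (pfst (psnd z)) (psnd (psnd z)))"
    and "computable_in G f" "computable_in G f'" "computable_in G f''"
  shows "decidable_in G (\<lambda>z. P (f z) (f' z) (f'' z))"
  using decidable_in_compose[OF assms(1), of "\<lambda>z. prod_encode (f z, prod_encode (f' z, f'' z))"]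
    assms(2-) by (simp add: computability)

lemma decidable_in_const [computability]: "decidable_in G (\<lambda>z. c)"
  unfolding decidable_in_def by (rule computable_in_const)

lemma decidable_in_not [computability]: "decidable_in G P \<Longrightarrow> decidable_in G (\<lambda>z. \<not> P z)"
  unfolding decidable_in_def
  by (drule computable_in_diff[OF computable_in_const[of G 1]])
    (erule back_subst[where P="computable_in G"], auto)

lemma decidable_in_conj [computability]:
  assumes "decidable_in G P" "decidable_in G Q"
  shows "decidable_in G (\<lambda>z. P z \<and> Q z)"
  unfolding decidable_in_def
  using computable_in_if[OF assms(1) assms(2)[unfolded decidable_in_def] computable_in_const[of G 0]]
  by (rule back_subst[where P="computable_in G"]) auto

lemma decidable_in_disj [computability]:
  "decidable_in G P \<Longrightarrow> decidable_in G Q \<Longrightarrow> decidable_in G (\<lambda>z. P z \<or> Q z)"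
  using decidable_in_not[OF decidable_in_conj[OF decidable_in_not decidable_in_not]] by simp

lemma decidable_in_imp [computability]:
  "decidable_in G P \<Longrightarrow> decidable_in G Q \<Longrightarrow> decidable_in G (\<lambda>z. P z \<longrightarrow> Q z)"
  unfolding imp_conv_disj by (intro computability)

lemma decidable_in_le [computability]:
  assumes "computable_in G f" "computable_in G f'"
  shows "decidable_in G (\<lambda>z. f z \<le> f' z)"
  unfolding decidable_in_def
  using computable_in_diff[OF computable_in_const[of G 1] computable_in_diff[OF assms]]
  by (rule back_subst[where P="computable_in G"]) auto

lemma decidable_in_less [computability]:
  "computable_in G f \<Longrightarrow> computable_in G f' \<Longrightarrow> decidable_in G (\<lambda>z. f z < f' z)"
  unfolding Suc_le_eq[symmetric] by (intro computability)

lemma decidable_in_eq [computability]: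
  "computable_in G f \<Longrightarrow> computable_in G f' \<Longrightarrow> decidable_in G (\<lambda>z. f z = f' z)"
  unfolding eq_iff by (intro computability)

lemma computable_in_Least [computability]:
  assumes "decidable_in G (\<lambda>z. P (pfst z) (psnd z))" and "\<And>z. \<exists>k. P k z"
  shows "computable_in G (\<lambda>z. LEAST k. P k z)"
proof -
  have "computable_in G (\<lambda>z. 1 - of_bool (P (pfst z) (psnd z)))"
    by (intro computability assms(1)[unfolded decidable_in_def])
  from computable_list_comp1[OF this[unfolded computable_in_iff_list],
      of 2 "\<lambda>xs. prod_encode (xs ! 0, xs ! 1)"]
  have "computable_list_in G 2 (\<lambda>xs. 1 - of_bool (P (xs ! 0) (xs ! 1)))"
    by (simp add: computable_list_prod_encode computable_list_proj)
  moreover have "(1 - of_bool (P k z) :: nat) = 0 \<longleftrightarrow> P k z" for k z by simp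
  ultimately show ?thesis
    using computable_list_Least[where F="\<lambda>k z. 1 - of_bool (P k z)"] assms(2)
    unfolding computable_in_iff_list by (simp only:)
qed

text \<open>The search for a counterexample is stopped at the bound, which makes it total; it gets
  as far as the bound exactly when there is no counterexample below.\<close>

lemma decidable_in_all_less [computability]:
  assumes "decidable_in G (\<lambda>z. P (pfst z) (psnd z))" "computable_in G b"
  shows "decidable_in G (\<lambda>z. \<forall>k<b z. P k z)"
proof -
  have ex: "\<exists>k. \<not> P k z \<or> b z \<le> k" for z
    by blast
  have "decidable_in G (\<lambda>z. b z \<le> (LEAST k. \<not> P k z \<or> b z \<le> k))"
    by (intro computability assms computable_in_compose[OF assms(2)] ex)
  moreover have "b z \<le> (LEAST k. \<not> P k z \<or> b z \<le> k) \<longleftrightarrow> (\<forall>k<b z. P k z)" for z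
  proof
    show "\<forall>k<b z. P k z" if "b z \<le> (LEAST k. \<not> P k z \<or> b z \<le> k)"
      using that not_less_Least[of _ "\<lambda>k. \<not> P k z \<or> b z \<le> k"] order_less_le_trans by blast
    show "b z \<le> (LEAST k. \<not> P k z \<or> b z \<le> k)" if "\<forall>k<b z. P k z"
      using that LeastI_ex[OF ex[of z]] by (meson not_le)
  qed
  ultimately show ?thesis by simp
qed

text \<open>A nonempty list is coded as \<open>Suc (prod_encode (x, list_encode l))\<close>, so
  \<open>psnd (m - 1)\<close> drops the head. On numbers that do not code a long enough list the
  value is arbitrary; uses are guarded by re-encoding.\<close>

definition code_nth :: "nat \<Rightarrow> nat \<Rightarrow> nat" where
  "code_nth i n = pfst (((\<lambda>m. psnd (m - 1)) ^^ i) n - 1)"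

lemma code_nth_list_encode: "i < length l \<Longrightarrow> code_nth i (list_encode l) = l ! i"
proof (induction i arbitrary: l)
  case 0
  then show ?case by (cases l) (auto simp: code_nth_def)
next
  case (Suc i)
  then obtain x l' where "l = x # l'" by (cases l) auto
  then show ?case
    using Suc by (simp add: code_nth_def funpow_Suc_right del: funpow.simps)
qed

lemma computable_in_code_nth [computability]:
  assumes "computable_in G f"
  shows "computable_in G (\<lambda>z. code_nth i (f z))"
proof -
  have "computable_in G (\<lambda>z. ((\<lambda>m. psnd (m - 1)) ^^ i) (f z))"
    by (induction i) (simp_all add: assms computability del: One_nat_def)
  then show ?thesis unfolding code_nth_def by (intro computability)
qed

lemma computable_in_oracle: "computable_in {g} g"
  by (auto simp: computable_in_def intro!: exI[of _ Query] rec_eval.query)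

lemma computable_in_trans:
  assumes "computable_in {g} f" "computable_in G g"
  shows "computable_in G f"
proof -
  obtain p q where "\<forall>n. rec_eval g p [n] (f n)" "\<forall>h\<in>G. \<forall>n. rec_eval h q [n] (g n)"
    using assms by (auto simp: computable_in_def)
  then have "\<forall>h\<in>G. \<forall>n. rec_eval h (subst_query q p) [n] (f n)"
    using rec_eval_subst_query by blast
  then show ?thesis by (auto simp: computable_in_def)
qed

lemma decidable_in_trans: "decidable_in {g} P \<Longrightarrow> computable_in G g \<Longrightarrow> decidable_in G P"
  unfolding decidable_in_def by (rule computable_in_trans)

lemma char_fun_of_bool: "char_fun X = (\<lambda>n. of_bool (n \<in> X))"
  by (auto simp: char_fun_def)

lemma turing_le_iff_decidable: "turing_le X Y \<longleftrightarrow> decidable_in {char_fun Y} (\<lambda>n. n \<in> X)"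
  by (simp add: turing_le_def decidable_in_def computable_in_def char_fun_of_bool)

lemma computable_set_decidable_in:
  assumes "computable_set X"
  shows "decidable_in G (\<lambda>n. n \<in> X)"
proof (rule decidable_in_trans[where g="\<lambda>_. 0"])
  show "decidable_in {\<lambda>_. 0} (\<lambda>n. n \<in> X)"
    using assms by (simp add: computable_set_def decidable_in_def computable_in_def char_fun_of_bool)
qed (rule computable_in_const)

lemma turing_le_refl: "turing_le X X"
  using computable_in_oracle[of "char_fun X"]
  by (simp add: turing_le_iff_decidable decidable_in_def char_fun_of_bool)

lemma turing_le_trans: "turing_le X Y \<Longrightarrow> turing_le Y W \<Longrightarrow> turing_le X W"
  unfolding turing_le_iff_decidable
  by (erule decidable_in_trans) (simp add: decidable_in_def char_fun_of_bool)


section \<open>Deciding the atomic diagram\<close>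

text \<open>The entries of a code are functions of the code, so the existential quantifiers in the
  diagram have only one candidate each. Re-encoding these candidates and comparing with
  \<open>z\<close> checks both the tag and the length. The premises follow the order of the tags 0
  to 9.\<close>

lemma decidable_in_atomic_diagram:
  fixes \<A> :: rs_structure
  assumes "decidable_in G (\<lambda>z. code_nth 1 z \<in> st_points \<A>)"
    and "decidable_in G (\<lambda>z. code_nth 2 z \<in> st_open \<A> (code_nth 1 z))"
    and "decidable_in G (\<lambda>z. code_nth 2 z \<in> carrier (st_ring \<A> (code_nth 1 z)))"
    and "decidable_in G (\<lambda>z. code_nth 2 z \<in> carrier (st_ring \<A> (code_nth 1 z)) \<and>
           code_nth 3 z \<in> carrier (st_ring \<A> (code_nth 1 z)) \<and>
           code_nth 4 z = code_nth 2 z \<oplus>\<^bsub>st_ring \<A> (code_nth 1 z)\<^esub> code_nth 3 z)"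
    and "decidable_in G (\<lambda>z. code_nth 2 z \<in> carrier (st_ring \<A> (code_nth 1 z)) \<and>
           code_nth 3 z \<in> carrier (st_ring \<A> (code_nth 1 z)) \<and>
           code_nth 4 z = code_nth 2 z \<otimes>\<^bsub>st_ring \<A> (code_nth 1 z)\<^esub> code_nth 3 z)"
    and "decidable_in G (\<lambda>z. code_nth 2 z = \<zero>\<^bsub>st_ring \<A> (code_nth 1 z)\<^esub>)"
    and "decidable_in G (\<lambda>z. code_nth 2 z = \<one>\<^bsub>st_ring \<A> (code_nth 1 z)\<^esub>)"
    and "decidable_in G (\<lambda>z. (code_nth 3 z, code_nth 4 z) \<in> st_res \<A> (code_nth 1 z) (code_nth 2 z))"
    and "decidable_in G (\<lambda>z. (code_nth 1 z, code_nth 2 z) \<in> st_to \<A>)"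
    and "decidable_in G (\<lambda>z. (code_nth 2 z, code_nth 3 z) \<in> st_from \<A> (code_nth 1 z))"
  shows "decidable_in G (\<lambda>z. z \<in> atomic_diagram \<A>)"
proof -
  note [simp del] = list_encode.simps
  note [simp] = code_nth_list_encode
  have "z \<in> atomic_diagram \<A> \<longleftrightarrow>
     (z = list_encode [0, code_nth 1 z] \<and> code_nth 1 z \<in> st_points \<A>) \<or>
     (z = list_encode [1, code_nth 1 z, code_nth 2 z] \<and>
        code_nth 2 z \<in> st_open \<A> (code_nth 1 z)) \<or>
     (z = list_encode [2, code_nth 1 z, code_nth 2 z] \<and>
        code_nth 2 z \<in> carrier (st_ring \<A> (code_nth 1 z))) \<or>
     (z = list_encode [3, code_nth 1 z, code_nth 2 z, code_nth 3 z, code_nth 4 z] \<and>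
        (code_nth 2 z \<in> carrier (st_ring \<A> (code_nth 1 z)) \<and>
         code_nth 3 z \<in> carrier (st_ring \<A> (code_nth 1 z)) \<and>
         code_nth 4 z = code_nth 2 z \<oplus>\<^bsub>st_ring \<A> (code_nth 1 z)\<^esub> code_nth 3 z)) \<or>
     (z = list_encode [4, code_nth 1 z, code_nth 2 z, code_nth 3 z, code_nth 4 z] \<and>
        (code_nth 2 z \<in> carrier (st_ring \<A> (code_nth 1 z)) \<and>
         code_nth 3 z \<in> carrier (st_ring \<A> (code_nth 1 z)) \<and>
         code_nth 4 z = code_nth 2 z \<otimes>\<^bsub>st_ring \<A> (code_nth 1 z)\<^esub> code_nth 3 z)) \<or>
     (z = list_encode [5, code_nth 1 z, code_nth 2 z] \<and>
        code_nth 2 z = \<zero>\<^bsub>st_ring \<A> (code_nth 1 z)\<^esub>) \<or>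
     (z = list_encode [6, code_nth 1 z, code_nth 2 z] \<and>
        code_nth 2 z = \<one>\<^bsub>st_ring \<A> (code_nth 1 z)\<^esub>) \<or>
     (z = list_encode [7, code_nth 1 z, code_nth 2 z, code_nth 3 z, code_nth 4 z] \<and>
        (code_nth 3 z, code_nth 4 z) \<in> st_res \<A> (code_nth 1 z) (code_nth 2 z)) \<or>
     (z = list_encode [8, code_nth 1 z, code_nth 2 z] \<and>
        (code_nth 1 z, code_nth 2 z) \<in> st_to \<A>) \<or>
     (z = list_encode [9, code_nth 1 z, code_nth 2 z, code_nth 3 z] \<and>
        (code_nth 2 z, code_nth 3 z) \<in> st_from \<A> (code_nth 1 z))" for z
    unfolding atomic_diagram_def Un_iff disj_assoc
    by (intro arg_cong2[where f="(\<or>)"]) (force+)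
  then show ?thesis
    by (simp only:) (intro computability assms)
qed

lemma list_encode_mem_atomic_diagram:
  "list_encode [0, x] \<in> atomic_diagram \<A> \<longleftrightarrow> x \<in> st_points \<A>"
  "list_encode [1, u, x] \<in> atomic_diagram \<A> \<longleftrightarrow> x \<in> st_open \<A> u"
  "list_encode [2, u, s] \<in> atomic_diagram \<A> \<longleftrightarrow> s \<in> carrier (st_ring \<A> u)"
  "list_encode [3, u, s, t, r] \<in> atomic_diagram \<A> \<longleftrightarrow>
     s \<in> carrier (st_ring \<A> u) \<and> t \<in> carrier (st_ring \<A> u) \<and> r = s \<oplus>\<^bsub>st_ring \<A> u\<^esub> t"
  "list_encode [4, u, s, t, r] \<in> atomic_diagram \<A> \<longleftrightarrow>
     s \<in> carrier (st_ring \<A> u) \<and> t \<in> carrier (st_ring \<A> u) \<and> r = s \<otimes>\<^bsub>st_ring \<A> u\<^esub> t"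
  "list_encode [6, u, r] \<in> atomic_diagram \<A> \<longleftrightarrow> r = \<one>\<^bsub>st_ring \<A> u\<^esub>"
  "list_encode [7, v, u, s, t] \<in> atomic_diagram \<A> \<longleftrightarrow> (s, t) \<in> st_res \<A> v u"
  "list_encode [8, x, z] \<in> atomic_diagram \<A> \<longleftrightarrow> (x, z) \<in> st_to \<A>"
  by (auto simp: atomic_diagram_def list_encode_eq simp del: list_encode.simps)


section \<open>Sets computable from every enumeration of a given set\<close>

text \<open>Programs are listed one by one in the generic construction and counted in the chain
  argument.\<close>

instance prog :: countable
  by countable_datatype

text \<open>\<open>g\<close> has to stay inside \<open>S\<close> but need not exhaust it. Such a
  partial enumeration remains one when \<open>S\<close> grows, and this is the source of
  monotonicity.\<close>

definition enumeration_prefix :: "nat set \<Rightarrow> nat list \<Rightarrow> (nat \<Rightarrow> nat) \<Rightarrow> bool" where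
  "enumeration_prefix S \<sigma> g \<longleftrightarrow>
     range g \<subseteq> insert 0 (Suc ` S) \<and> (\<forall>i<length \<sigma>. g i = \<sigma> ! i)"

lemma enumeration_prefix_mono:
  "enumeration_prefix S \<sigma> g \<Longrightarrow> S \<subseteq> S' \<Longrightarrow> enumeration_prefix S' \<sigma> g"
  unfolding enumeration_prefix_def by (meson image_mono insert_mono order_trans)

lemma enumeration_prefix_append:
  "enumeration_prefix S (\<sigma> @ \<rho>) g \<Longrightarrow> enumeration_prefix S \<sigma> g"
  unfolding enumeration_prefix_def by (auto simp: nth_append)

text \<open>Otherwise a generic enumeration, built by finite extensions that diagonalise against
  each program in turn, would not compute \<open>f\<close>.\<close>

lemma computable_from_all_enumerations:
  assumes f: "\<And>g. enumerates g S \<Longrightarrow> \<exists>p. \<forall>n. rec_eval g p [n] (f n)"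
  obtains p \<sigma> where
    "\<And>n y. (\<exists>g. enumeration_prefix S \<sigma> g \<and> rec_eval g p [n] y) \<longleftrightarrow> y = f n"
proof (rule ccontr)
  define W where "W = insert 0 (Suc ` S)"
  assume "\<not> thesis"
  then have neg: "\<exists>n y. (\<exists>g. enumeration_prefix S \<sigma> g \<and> rec_eval g p [n] y) \<noteq> (y = f n)" for p \<sigma>
    using that by blast
  have "\<exists>\<rho>. set \<rho> \<subseteq> W \<and> (\<forall>g. enumeration_prefix S (\<sigma> @ \<rho>) g \<longrightarrow> (\<exists>n. \<not> rec_eval g p [n] (f n)))"
    for \<sigma> p
  proof -
    obtain n y where ny: "(\<exists>g. enumeration_prefix S \<sigma> g \<and> rec_eval g p [n] y) \<noteq> (y = f n)"
      using neg by blast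
    show ?thesis
    proof (cases "y = f n")
      \<comment> \<open>No continuation of \<open>\<sigma>\<close> makes \<open>p\<close> output
        \<open>f n\<close> at \<open>n\<close>, so nothing has to be added.\<close>
      case True
      then have "\<forall>g. enumeration_prefix S (\<sigma> @ []) g \<longrightarrow> (\<exists>n. \<not> rec_eval g p [n] (f n))"
        using ny by auto
      then show ?thesis by (metis empty_set empty_subsetI)
    next
      \<comment> \<open>Some continuation gives a wrong value; fixing enough of it makes the error
        permanent.\<close>
      case False
      then obtain g where g: "enumeration_prefix S \<sigma> g" "rec_eval g p [n] y"
        using ny by blast
      obtain m where m: "\<forall>h. (\<forall>i<m. h i = g i) \<longrightarrow> rec_eval h p [n] y"
        using rec_eval_use[OF g(2)] by blast
      \<comment> \<open>With this segment the prefix has length \<open>length \<sigma> + m\<close>,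
        so it covers the use \<open>m\<close> whatever the length of
        \<open>\<sigma>\<close>.\<close>
      define \<rho> where "\<rho> = map g [length \<sigma>..<length \<sigma> + m]"
      have "set \<rho> \<subseteq> W"
        using g(1) by (auto simp: \<rho>_def W_def enumeration_prefix_def)
      moreover have "\<not> rec_eval h p [n] (f n)" if "enumeration_prefix S (\<sigma> @ \<rho>) h" for h
      proof -
        have "h i = g i" if "i < m" for i
        proof -
          have "h i = (\<sigma> @ \<rho>) ! i"
            using \<open>enumeration_prefix S (\<sigma> @ \<rho>) h\<close> that
            by (simp add: enumeration_prefix_def \<rho>_def)
          then show ?thesis
            using g(1) that by (auto simp: nth_append \<rho>_def enumeration_prefix_def)
        qed
        then show ?thesis
          using m False rec_eval_deterministic by blast
      qed
      ultimately show ?thesis by blast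
    qed
  qed
  then obtain \<rho> where \<rho>: "\<And>\<sigma> p. set (\<rho> \<sigma> p) \<subseteq> W"
    "\<And>\<sigma> p g. enumeration_prefix S (\<sigma> @ \<rho> \<sigma> p) g \<Longrightarrow> \<exists>n. \<not> rec_eval g p [n] (f n)"
    by metis
  \<comment> \<open>Stage \<open>k\<close> defeats the program numbered \<open>k\<close> and then
    outputs \<open>k\<close> if it belongs to \<open>S\<close>. The last entry is added in either
    case, so the lengths grow and the limit is a total function.\<close>
  define s where "s = rec_nat [] (\<lambda>k \<sigma>. \<sigma> @ \<rho> \<sigma> (from_nat k) @ [if k \<in> S then Suc k else 0])"
  have s_Suc: "s (Suc k) = s k @ \<rho> (s k) (from_nat k) @ [if k \<in> S then Suc k else 0]" for k
    by (simp add: s_def)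
  have s_W: "set (s k) \<subseteq> W" for k
  proof (induction k)
    case 0
    show ?case by (simp add: s_def)
  next
    case (Suc k)
    then show ?case using \<rho>(1)[of "s k" "from_nat k"] by (auto simp: s_Suc W_def)
  qed
  have len: "k \<le> length (s k)" for k
    by (induction k) (auto simp: s_Suc)
  have prefix: "\<exists>\<tau>. s l = s k @ \<tau>" if "k \<le> l" for k l
    using that by (induction l rule: dec_induct) (auto simp: s_Suc)
  \<comment> \<open>\<open>s (Suc i)\<close> is longer than \<open>i\<close> and later stages only
    extend it, so this is the limit of the prefixes.\<close>
  define g where "g i = s (Suc i) ! i" for i
  have g: "g i = s k ! i" if "i < length (s k)" for i k
  proof -
    have "i < length (s (Suc i))" using len[of "Suc i"] by simp
    then show ?thesis
      using prefix[of k "Suc i"] prefix[of "Suc i" k] that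
      by (metis g_def nat_le_linear nth_append)
  qed
  have g_prefix: "enumeration_prefix S (s k) g" for k
    unfolding enumeration_prefix_def
  proof
    show "range g \<subseteq> insert 0 (Suc ` S)"
    proof
      fix y assume "y \<in> range g"
      then obtain i where "y = s (Suc i) ! i" by (auto simp: g_def)
      moreover have "i < length (s (Suc i))" using len[of "Suc i"] by simp
      ultimately show "y \<in> insert 0 (Suc ` S)"
        using s_W[of "Suc i"] nth_mem by (fastforce simp: W_def)
    qed
  qed (use g in blast)
  have "enumerates g S"
    unfolding enumerates_def
  proof (intro Set.set_eqI iffI)
    fix n assume "n \<in> S"
    then have "s (Suc n) ! (length (s (Suc n)) - 1) = Suc n"
      by (simp add: s_Suc nth_append)
    moreover have "length (s (Suc n)) - 1 < length (s (Suc n))"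
      by (simp add: s_Suc)
    ultimately have "g (length (s (Suc n)) - 1) = Suc n"
      using g by metis
    then show "n \<in> {n. \<exists>k. g k = Suc n}" by blast
  next
    fix n assume "n \<in> {n. \<exists>k. g k = Suc n}"
    then obtain k where "g k = Suc n" by blast
    moreover have "g k \<in> insert 0 (Suc ` S)"
      using g_prefix[of 0] by (auto simp only: enumeration_prefix_def)
    ultimately show "n \<in> S" by auto
  qed
  then obtain p where p: "\<forall>n. rec_eval g p [n] (f n)" using f by blast
  have "enumeration_prefix S (s (to_nat p) @ \<rho> (s (to_nat p)) p) g"
    using g_prefix[of "Suc (to_nat p)"] enumeration_prefix_append[of S "s (to_nat p) @ \<rho> (s (to_nat p)) p"]
    by (simp add: s_Suc)
  then show False using \<rho>(2) p by blast
qed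

text \<open>The sets \<open>S r\<close> that share a program and a prefix of \<open>computable_from_all_enumerations\<close>
  have the same \<open>D r\<close>, because they form a chain; but there are only countably many programs
  and prefixes.\<close>

lemma chain_not_computable_from_all_enumerations:
  fixes S :: "real \<Rightarrow> nat set" and D :: "real \<Rightarrow> nat set"
  assumes mono: "\<And>r r'. r \<le> r' \<Longrightarrow> S r \<subseteq> S r'"
    and inj: "inj D"
    and D: "\<And>r g. enumerates g (S r) \<Longrightarrow> decidable_in {g} (\<lambda>n. n \<in> D r)"
  shows False
proof -
  have "\<exists>p\<sigma>. \<forall>n y. (\<exists>g. enumeration_prefix (S r) (snd p\<sigma>) g \<and> rec_eval g (fst p\<sigma>) [n] y) \<longleftrightarrow>
      y = char_fun (D r) n" for r
  proof -
    have "\<exists>p. \<forall>n. rec_eval g p [n] (char_fun (D r) n)" if "enumerates g (S r)" for g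
      using D[OF that] by (simp add: decidable_in_def computable_in_def char_fun_of_bool)
    from computable_from_all_enumerations[of "S r" "char_fun (D r)", OF this]
    show ?thesis by (metis fst_conv snd_conv)
  qed
  then obtain c where c: "\<And>r n y. (\<exists>g. enumeration_prefix (S r) (snd (c r)) g \<and>
      rec_eval g (fst (c r)) [n] y) \<longleftrightarrow> y = char_fun (D r) n"
    by metis
  have D_eq: "D r = D r'" if "c r = c r'" "r \<le> r'" for r r'
  proof -
    \<comment> \<open>A partial enumeration that yields the value for \<open>S r\<close> is also one
      of \<open>S r'\<close>. There the same program and prefix admit only one output, the value for
      \<open>D r'\<close>.\<close>
    have "char_fun (D r) n = char_fun (D r') n" for n
      using c[of r n "char_fun (D r) n"] c[of r' n "char_fun (D r) n"] that
        enumeration_prefix_mono[OF _ mono[OF that(2)]] by auto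
    then show ?thesis by (auto simp: char_fun_def split: if_splits) (metis zero_neq_one)+
  qed
  have "inj c"
    by (rule injI) (metis D_eq inj injD linear)
  then have "countable (UNIV :: real set)"
    using countableI'[of "to_nat \<circ> c" UNIV] by (simp add: inj_compose)
  then show False using uncountable_UNIV_real by blast
qed

text \<open>The gap keeps each \<open>Suc (x k)\<close> outside the transversal. These free numbers
  will code the cuts.\<close>

lemma infinite_sets_sparse_transversal:
  fixes I :: "nat \<Rightarrow> nat set"
  assumes "\<And>k. infinite (I k)"
  obtains x where "\<And>k. x k \<in> I k" "\<And>k. Suc (x k) < x (Suc k)"
proof -
  have "\<exists>x. \<forall>k. x k \<in> I k \<and> Suc (x k) < x (Suc k)"
  proof (rule dependent_nat_choice)
    show "\<exists>x. x \<in> I 0" using assms[of 0] by (metis all_not_in_conv finite.emptyI)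
    show "\<exists>y. y \<in> I (Suc k) \<and> Suc x < y" for x k
      using assms[of "Suc k"] by (meson infinite_nat_iff_unbounded)
  qed
  then show ?thesis using that by blast
qed


section \<open>Recoded copies of structures\<close>

text \<open>The elements of a copy carry a witness in their second component.\<close>

definition recoded :: "(nat \<Rightarrow> nat) \<Rightarrow> (nat \<Rightarrow> nat \<Rightarrow> nat) \<Rightarrow> rs_structure \<Rightarrow> rs_structure" where
  "recoded h k \<A> =
     \<lparr>st_points = h ` st_points \<A>,
      st_open = (\<lambda>u. h ` st_open \<A> u),
      st_ring = (\<lambda>u. \<lparr>carrier = k u ` carrier (st_ring \<A> u),
                     mult = (\<lambda>s t. k u (pfst s \<otimes>\<^bsub>st_ring \<A> u\<^esub> pfst t)),
                     one = k u \<one>\<^bsub>st_ring \<A> u\<^esub>,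
                     zero = k u \<zero>\<^bsub>st_ring \<A> u\<^esub>,
                     add = (\<lambda>s t. k u (pfst s \<oplus>\<^bsub>st_ring \<A> u\<^esub> pfst t))\<rparr>),
      st_res = (\<lambda>v u. map_prod (k v) (k u) ` st_res \<A> v u),
      st_to = map_prod h id ` st_to \<A>,
      st_from = (\<lambda>u. map_prod id (k u) ` st_from \<A> u)\<rparr>"

text \<open>\<open>pfst\<close> is a common left inverse of the coding maps, so they are injective,
  and decoding, operating and recoding transports the ring structure.\<close>

lemma structure_iso_recoded:
  assumes h: "\<And>x. pfst (h x) = x" and k: "\<And>u s. pfst (k u s) = s"
  shows "structure_iso \<A> (recoded h k \<A>)"
  unfolding structure_iso_def
proof (intro exI conjI allI)
  show "bij_betw h (st_points \<A>) (st_points (recoded h k \<A>))"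
    by (auto simp: recoded_def bij_betw_def intro!: inj_onI) (metis h)
  show "k u \<in> ring_iso (st_ring \<A> u) (st_ring (recoded h k \<A>) u)" for u
    by (auto simp: ring_iso_def recoded_def ring_hom_def k bij_betw_def intro!: inj_onI) (metis k)
qed (auto simp: recoded_def)

lemma structure_iso_refl: "structure_iso \<A> \<A>"
  unfolding structure_iso_def
  by (intro exI[of _ id] exI[of _ "\<lambda>_. id"])
    (auto simp: ring_iso_def ring_hom_def map_prod.id)

definition witness_code :: "(nat \<Rightarrow> nat \<Rightarrow> bool) \<Rightarrow> nat \<Rightarrow> nat" where
  "witness_code Q x = prod_encode (x, LEAST k. Q x k)"

text \<open>Decidable whenever \<open>Q\<close> is, although the existence of a witness may be only
  enumerable. The bounded quantifier checks leastness, which gives every element just one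
  code.\<close>

definition is_witness_code :: "(nat \<Rightarrow> nat \<Rightarrow> bool) \<Rightarrow> nat \<Rightarrow> bool" where
  "is_witness_code Q n \<longleftrightarrow> Q (pfst n) (psnd n) \<and> (\<forall>k<psnd n. \<not> Q (pfst n) k)"

lemma pfst_witness_code [simp]: "pfst (witness_code Q x) = x"
  by (simp add: witness_code_def)

lemma is_witness_code_iff:
  "is_witness_code Q n \<longleftrightarrow> (\<exists>k. Q (pfst n) k) \<and> n = witness_code Q (pfst n)"
proof
  assume n: "is_witness_code Q n"
  have "(LEAST k. Q (pfst n) k) = psnd n"
    using n by (intro Least_equality) (auto simp: is_witness_code_def not_less[symmetric])
  then show "(\<exists>k. Q (pfst n) k) \<and> n = witness_code Q (pfst n)"
    using n by (auto simp: witness_code_def is_witness_code_def)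
next
  assume n: "(\<exists>k. Q (pfst n) k) \<and> n = witness_code Q (pfst n)"
  then have "psnd n = (LEAST k. Q (pfst n) k)"
    by (metis psnd_prod_encode witness_code_def)
  then show "is_witness_code Q n"
    using n by (auto simp: is_witness_code_def intro: LeastI dest: not_less_Least)
qed

lemma eq_witness_code_iff:
  "\<exists>k. Q x k \<Longrightarrow> n = witness_code Q x \<longleftrightarrow> is_witness_code Q n \<and> pfst n = x"
  by (auto simp: is_witness_code_iff)

lemma image_witness_code:
  assumes "\<And>x. x \<in> X \<Longrightarrow> \<exists>k. Q x k"
  shows "n \<in> witness_code Q ` X \<longleftrightarrow> is_witness_code Q n \<and> pfst n \<in> X"
  using assms by (auto simp: is_witness_code_iff)

lemma decidable_in_is_witness_code:
  assumes "decidable_in G (\<lambda>z. Q (pfst z) (pfst (psnd z)) (psnd (psnd z)))"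
    and "computable_in G f" "computable_in G f'"
  shows "decidable_in G (\<lambda>z. is_witness_code (Q (f z)) (f' z))"
  unfolding is_witness_code_def
  by (intro computability decidable_in_compose3[OF assms(1)] assms(2,3)
      computable_in_compose[OF assms(2)] computable_in_compose[OF assms(3)])


section \<open>Induced spaces\<close>

lemma topspace_induced [simp]:
  "Y \<subseteq> topspace T \<Longrightarrow> topspace (rs_top (induced_space T R F Y)) = Y"
  by (auto simp: induced_space_def element_space_def)

lemma rs_preimage_induced:
  "Y \<subseteq> topspace T \<Longrightarrow> rs_preimage (induced_space T R F Y) (\<lambda>x. x) V = V \<inter> Y"
  by (auto simp: rs_preimage_def)

lemma induced_sections_antimono: "V \<subseteq> W \<Longrightarrow> induced_sections T F W \<subseteq> induced_sections T F V"
  by (auto simp: induced_sections_def)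

lemma inclusion_map_morphism:
  assumes R: "ring R" and Y: "Y \<subseteq> Y'" "Y' \<subseteq> topspace T"
  shows "inclusion_morphism T R F Y Y' (inclusion_map R Y)"
proof -
  interpret ring R by (rule R)
  have YT: "Y \<subseteq> topspace T" using Y by blast
  note pre = rs_preimage_induced[OF YT] rs_preimage_induced[OF Y(2)]
  have sub: "V \<subseteq> Y'" if "openin (subtopology T Y') V" for V
    using that openin_subset by fastforce
  have "continuous_map (subtopology T Y) (subtopology T Y') (\<lambda>x. x)"
    using Y by (auto simp: continuous_map_in_subtopology continuous_map_from_subtopology)
  \<comment> \<open>If \<open>V\<close> misses \<open>Y\<close> the target is the zero ring;
    otherwise every section over \<open>V\<close> is a section over the smaller set
    \<open>V \<inter> Y\<close>.\<close>
  moreover have "(\<lambda>s. if V \<inter> Y = {} then \<zero>\<^bsub>R\<^esub> else s)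
      \<in> ring_hom (rs_ring (induced_space T R F Y') V) (rs_ring (induced_space T R F Y) (V \<inter> Y))" for V
    using induced_sections_antimono[of "V \<inter> Y" V T F]
    by (auto simp: ring_hom_def induced_space_def element_space_def)
  moreover have "(if W \<inter> Y = {} then \<zero>\<^bsub>R\<^esub> else rs_restr (induced_space T R F Y') V W s) =
      rs_restr (induced_space T R F Y) (V \<inter> Y) (W \<inter> Y) (if V \<inter> Y = {} then \<zero>\<^bsub>R\<^esub> else s)"
    if "W \<subseteq> V" for V W s
    using that by (auto simp: induced_space_def element_space_def)
  ultimately have "rs_morphism (induced_space T R F Y) (induced_space T R F Y') (inclusion_map R Y)"
    unfolding rs_morphism_def inclusion_map_def fst_conv snd_conv pre
    by (auto simp: induced_space_def element_space_def)
  moreover have "rs_map_eq (induced_space T R F Y) (element_space T R F)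
       (rs_comp (induced_space T R F Y') (inclusion_map R Y') (inclusion_map R Y)) (inclusion_map R Y)"
    using Y(1) by (auto simp: rs_map_eq_def rs_comp_def inclusion_map_def pre)
  ultimately show ?thesis by (simp add: inclusion_morphism_def)
qed

text \<open>Commuting with the inclusions forces the underlying map to fix every point of
  \<open>Y\<close>, and a continuous map sends points of its source to points of its target.\<close>

lemma inclusion_morphism_imp_subset:
  assumes "inclusion_morphism T R F Y Y' m" "Y \<subseteq> topspace T"
  shows "Y \<subseteq> Y'"
proof
  fix x assume x: "x \<in> Y"
  have "fst m x = x"
    using assms x by (auto simp: inclusion_morphism_def rs_map_eq_def rs_comp_def inclusion_map_def)
  moreover have "continuous_map (subtopology T Y) (subtopology T Y') (fst m)"
    using assms by (simp add: inclusion_morphism_def rs_morphism_def induced_space_def element_space_def)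
  then have "fst m ` topspace (subtopology T Y) \<subseteq> topspace (subtopology T Y')"
    by (rule continuous_map_image_subset_topspace)
  moreover have "x \<in> topspace (subtopology T Y)"
    using assms(2) x by auto
  ultimately have "x \<in> topspace (subtopology T Y')"
    by (metis image_subset_iff)
  then show "x \<in> Y'" by simp
qed

lemma embeddable_iff_subset:
  assumes "ring R" "Y \<subseteq> topspace T" "Y' \<subseteq> topspace T"
  shows "embeddable T R F Y Y' \<longleftrightarrow> Y \<subseteq> Y'"
proof
  assume "embeddable T R F Y Y'"
  then show "Y \<subseteq> Y'"
    using assms inclusion_morphism_imp_subset by (fastforce simp: embeddable_def)
next
  assume Y: "Y \<subseteq> Y'"
  have "embedding_map (subtopology T Y) (subtopology T Y') (\<lambda>x. x)"
    using Y assms(2) homeomorphic_map_id[of "subtopology T Y"]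
    by (simp add: id_def embedding_map_def subtopology_subtopology Int_absorb1 Int_absorb2)
  then show "embeddable T R F Y Y'"
    using inclusion_map_morphism[OF assms(1) Y assms(3), of F]
    by (auto simp: embeddable_def induced_space_def element_space_def inclusion_map_def)
qed


lemma mem_map_prod_image:
  "(s, t) \<in> map_prod f g ` X \<longleftrightarrow> (\<exists>a b. (a, b) \<in> X \<and> s = f a \<and> t = g b)"
  by force

section \<open>Coded subspaces and their copies\<close>

locale coded_ringed_space =
  fixes T :: "nat topology" and R :: "nat ring" and F :: "nat set \<Rightarrow> nat set"
    and U :: "nat \<Rightarrow> nat set" and A B :: "nat set" and e :: "nat \<Rightarrow> nat"
  assumes elements: "ringed_space_of_elements T R F"
    and opens: "range U = {V. openin T V}"
    and computable_Z: "computable_structure (ambient_structure T R F U)"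
    and A_sub: "A \<subseteq> topspace T"
    and A_common: "\<And>V. openin T V \<Longrightarrow> V \<noteq> {} \<Longrightarrow> A \<subseteq> V"
    and A_empty: "A = {} \<Longrightarrow> \<not> (\<exists>C. C \<noteq> {} \<and> (\<forall>V. openin T V \<and> V \<noteq> {} \<longrightarrow> C \<subseteq> V))"
    and A_computable: "computable_set A"
    and B_sub: "B \<subseteq> topspace T"
    and B_computable: "computable_set B"
    and e_enum: "bij_betw e {0<..} (topspace T - (A \<union> B))"
    and e_computable: "computable_fun_on {0<..} e"
    and le_T: "\<And>X. X \<subseteq> {0<..} \<Longrightarrow>
          turing_le (section_set T R F U (coded_subset A B e X)) X"
    and le_e: "\<And>X. X \<subseteq> {0<..} \<Longrightarrow>
          enum_le (section_set T R F U (coded_subset A B e X)) X"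
begin

sublocale R: ring R
  using elements by (simp add: ringed_space_of_elements_def)

abbreviation ZX :: "nat set \<Rightarrow> nat set" where "ZX \<equiv> coded_subset A B e"

abbreviation space_diagram :: "nat set" where
  "space_diagram \<equiv> atomic_diagram (ambient_structure T R F U)"

definition ambient_sections :: "nat \<Rightarrow> nat set" where
  "ambient_sections u = carrier (rs_ring (element_space T R F) (U u))"

definition sections_on :: "nat set \<Rightarrow> nat \<Rightarrow> nat set" where
  "sections_on Y u = carrier (rs_ring (induced_space T R F Y) (U u \<inter> Y))"

lemma openin_iff_range_U: "openin T V \<longleftrightarrow> V \<in> range U"
  by (simp add: opens)

lemma openin_U: "openin T (U u)"
  by (simp add: openin_iff_range_U)

lemma U_subset: "U u \<subseteq> topspace T"
  by (rule openin_subset[OF openin_U])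

lemma subring_F: "openin T V \<Longrightarrow> V \<noteq> {} \<Longrightarrow> subring (F V) R"
  using elements by (simp add: ringed_space_of_elements_def)

lemma F_antimono: "openin T V \<Longrightarrow> openin T W \<Longrightarrow> W \<noteq> {} \<Longrightarrow> W \<subseteq> V \<Longrightarrow> F V \<subseteq> F W"
  using elements by (simp add: ringed_space_of_elements_def)

lemma ambient_sections_eq:
  "ambient_sections u = (if U u = {} then {\<zero>\<^bsub>R\<^esub>} else F (U u))"
  by (simp add: ambient_sections_def element_space_def)

lemma sections_on_eq:
  "sections_on Y u = (if U u \<inter> Y = {} then {\<zero>\<^bsub>R\<^esub>} else induced_sections T F (U u \<inter> Y))"
  by (simp add: sections_on_def induced_space_def element_space_def)

lemma mem_sections_on_nonempty:
  assumes "U u \<inter> Y \<noteq> {}"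
  shows "s \<in> sections_on Y u \<longleftrightarrow> (\<exists>w. U u \<inter> Y \<subseteq> U w \<and> s \<in> F (U w))"
  using assms unfolding sections_on_eq induced_sections_def openin_iff_range_U by auto

lemma zero_mem_ambient_sections: "\<zero>\<^bsub>R\<^esub> \<in> ambient_sections u"
  using subringE(2)[OF subring_F[OF openin_U]] by (simp add: ambient_sections_eq)

lemma ambient_sections_subset_carrier: "ambient_sections u \<subseteq> carrier R"
  using subringE(1)[OF subring_F[OF openin_U]] by (simp add: ambient_sections_eq)

lemma ambient_sections_subset_sections_on:
  assumes "U u \<inter> Y \<noteq> {}"
  shows "ambient_sections u \<subseteq> sections_on Y u"
  using mem_sections_on_nonempty[OF assms] assms by (auto simp: ambient_sections_eq)

lemma zero_mem_sections_on: "\<zero>\<^bsub>R\<^esub> \<in> sections_on Y u"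
  using ambient_sections_subset_sections_on[of u Y] zero_mem_ambient_sections[of u]
  by (cases "U u \<inter> Y = {}") (auto simp: sections_on_eq)

lemma one_mem_sections_on:
  assumes "U u \<inter> Y \<noteq> {}"
  shows "\<one>\<^bsub>R\<^esub> \<in> sections_on Y u"
proof -
  have "U u \<noteq> {}" using assms by blast
  then have "\<one>\<^bsub>R\<^esub> \<in> ambient_sections u"
    using subringE(3)[OF subring_F[OF openin_U[of u]]] by (simp add: ambient_sections_eq)
  then show ?thesis using ambient_sections_subset_sections_on[OF assms] by blast
qed

lemma sections_on_subset_carrier: "sections_on Y u \<subseteq> carrier R"
proof (cases "U u \<inter> Y = {}")
  case False
  show ?thesis
  proof
    fix s assume "s \<in> sections_on Y u"
    then obtain w where "U u \<inter> Y \<subseteq> U w" "s \<in> F (U w)"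
      using mem_sections_on_nonempty[OF False] by blast
    moreover from this have "U w \<noteq> {}" using False by blast
    ultimately show "s \<in> carrier R"
      using subringE(1)[OF subring_F[OF openin_U[of w]]] by blast
  qed
qed (simp add: sections_on_eq)

text \<open>Nonemptiness is essential: over the empty set the sections collapse to zero.\<close>

lemma sections_on_antimono:
  "U u \<subseteq> U v \<Longrightarrow> U u \<inter> Y \<noteq> {} \<Longrightarrow> sections_on Y v \<subseteq> sections_on Y u"
  using induced_sections_antimono[of "U u \<inter> Y" "U v \<inter> Y" T F]
  by (auto simp: sections_on_eq)

text \<open>Two induced sections come from ambient open sets containing
  \<open>U u \<inter> Y\<close>, and both live over the intersection of these. Sums and products of
  induced sections can thus be looked up in one of the ambient rings, whose operations the ambient
  diagram describes.\<close>

lemma sections_on_common: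
  assumes "a \<in> sections_on Y u" "b \<in> sections_on Y u"
  obtains w where "a \<in> ambient_sections w" "b \<in> ambient_sections w"
    "ambient_sections w \<subseteq> sections_on Y u"
    "a \<oplus>\<^bsub>R\<^esub> b \<in> ambient_sections w" "a \<otimes>\<^bsub>R\<^esub> b \<in> ambient_sections w"
proof (cases "U u \<inter> Y = {}")
  case True
  \<comment> \<open>The empty open set has an index as well, and its ring is the zero ring.\<close>
  obtain w where "U w = {}"
    using openin_empty[of T] unfolding openin_iff_range_U by fastforce
  moreover have "a = \<zero>\<^bsub>R\<^esub>" "b = \<zero>\<^bsub>R\<^esub>" using assms True by (auto simp: sections_on_eq)
  ultimately show ?thesis
    using zero_mem_sections_on[of Y u] by (intro that[of w]) (auto simp: ambient_sections_eq)
next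
  case False
  then obtain w1 w2 where w: "U u \<inter> Y \<subseteq> U w1" "a \<in> F (U w1)" "U u \<inter> Y \<subseteq> U w2" "b \<in> F (U w2)"
    using assms by (auto simp: mem_sections_on_nonempty)
  obtain w where uw: "U w = U w1 \<inter> U w2"
    using openin_Int[OF openin_U[of w1] openin_U[of w2]] unfolding openin_iff_range_U by fastforce
  then have ne: "U w \<noteq> {}" using w False by blast
  have ab: "a \<in> F (U w)" "b \<in> F (U w)"
    using w F_antimono[OF openin_U[of w1] openin_U[of w] ne]
      F_antimono[OF openin_U[of w2] openin_U[of w] ne] uw by auto
  note sr = subring_F[OF openin_U[of w] ne]
  show ?thesis
  proof (rule that[of w])
    show "ambient_sections w \<subseteq> sections_on Y u"
    proof
      fix s assume "s \<in> ambient_sections w"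
      then have "s \<in> F (U w)" using ne by (simp add: ambient_sections_eq)
      moreover have "U u \<inter> Y \<subseteq> U w" using uw w by simp
      ultimately show "s \<in> sections_on Y u" using mem_sections_on_nonempty[OF False] by blast
    qed
  qed (use ab ne subringE(6,7)[OF sr] in \<open>auto simp: ambient_sections_eq\<close>)
qed

text \<open>The last clause is a test for inclusion: zero is a section over every open set and
  restricts to zero, so this pair is in the graph exactly when the restriction symbol belongs to the
  language.\<close>

lemma ambient_structure_simps:
  "st_points (ambient_structure T R F U) = topspace T"
  "st_open (ambient_structure T R F U) u = U u"
  "carrier (st_ring (ambient_structure T R F U) u) = ambient_sections u"
  "mult (st_ring (ambient_structure T R F U) u) = mult R"
  "add (st_ring (ambient_structure T R F U) u) = add R"
  "one (st_ring (ambient_structure T R F U) u) = (if U u = {} then \<zero>\<^bsub>R\<^esub> else \<one>\<^bsub>R\<^esub>)"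
  "(\<zero>\<^bsub>R\<^esub>, \<zero>\<^bsub>R\<^esub>) \<in> st_res (ambient_structure T R F U) v u \<longleftrightarrow> U u \<subseteq> U v"
proof -
  have pre: "rs_preimage (element_space T R F) (fst rs_id) (U w) = U w" for w
    using U_subset[of w] by (auto simp: rs_preimage_def rs_id_def element_space_def)
  note simps = ambient_structure_def structure_over_def Let_def pre
  show "st_points (ambient_structure T R F U) = topspace T"
    "st_open (ambient_structure T R F U) u = U u"
    "carrier (st_ring (ambient_structure T R F U) u) = ambient_sections u"
    "mult (st_ring (ambient_structure T R F U) u) = mult R"
    "add (st_ring (ambient_structure T R F U) u) = add R"
    "one (st_ring (ambient_structure T R F U) u) = (if U u = {} then \<zero>\<^bsub>R\<^esub> else \<one>\<^bsub>R\<^esub>)"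
    unfolding simps by (simp_all add: element_space_def ambient_sections_eq)
  show "(\<zero>\<^bsub>R\<^esub>, \<zero>\<^bsub>R\<^esub>) \<in> st_res (ambient_structure T R F U) v u \<longleftrightarrow> U u \<subseteq> U v"
    unfolding simps using zero_mem_ambient_sections[of v]
    by (auto simp: ambient_sections_def element_space_def)
qed

lemma induced_structure_simps:
  assumes "Y \<subseteq> topspace T"
  shows "st_points (induced_structure T R F U Y) = Y"
    "st_open (induced_structure T R F U Y) u = U u \<inter> Y"
    "carrier (st_ring (induced_structure T R F U Y) u) = sections_on Y u"
    "mult (st_ring (induced_structure T R F U Y) u) = mult R"
    "add (st_ring (induced_structure T R F U Y) u) = add R"
    "zero (st_ring (induced_structure T R F U Y) u) = zero R"
    "one (st_ring (induced_structure T R F U Y) u) = (if U u \<inter> Y = {} then \<zero>\<^bsub>R\<^esub> else \<one>\<^bsub>R\<^esub>)"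
    "st_res (induced_structure T R F U Y) v u =
       {(s, t). U u \<subseteq> U v \<and> s \<in> sections_on Y v \<and> t = (if U u \<inter> Y = {} then \<zero>\<^bsub>R\<^esub> else s)}"
    "st_to (induced_structure T R F U Y) = {(x, y). x \<in> Y \<and> y = x}"
    "st_from (induced_structure T R F U Y) u =
       {(s, t). s \<in> ambient_sections u \<and> t = (if U u \<inter> Y = {} then \<zero>\<^bsub>R\<^esub> else s)}"
proof -
  have pre: "rs_preimage (induced_space T R F Y) (fst (inclusion_map R Y)) V = V \<inter> Y" for V
    using rs_preimage_induced[OF assms] by (simp add: inclusion_map_def)
  have restr: "rs_restr (induced_space T R F Y) V W s = (if W = {} then \<zero>\<^bsub>R\<^esub> else s)" for V W s
    by (simp add: induced_space_def element_space_def)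
  have ops: "mult (rs_ring (induced_space T R F Y) V) = mult R"
    "add (rs_ring (induced_space T R F Y) V) = add R"
    "zero (rs_ring (induced_space T R F Y) V) = zero R"
    "one (rs_ring (induced_space T R F Y) V) = (if V = {} then \<zero>\<^bsub>R\<^esub> else \<one>\<^bsub>R\<^esub>)" for V
    by (auto simp: induced_space_def element_space_def)
  note simps = induced_structure_def structure_over_def Let_def pre restr ops
    sections_on_def[symmetric] ambient_sections_def[symmetric] topspace_induced[OF assms]
  show "st_points (induced_structure T R F U Y) = Y"
    "st_open (induced_structure T R F U Y) u = U u \<inter> Y"
    "carrier (st_ring (induced_structure T R F U Y) u) = sections_on Y u"
    "mult (st_ring (induced_structure T R F U Y) u) = mult R"
    "add (st_ring (induced_structure T R F U Y) u) = add R"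
    "zero (st_ring (induced_structure T R F U Y) u) = zero R"
    "one (st_ring (induced_structure T R F U Y) u) = (if U u \<inter> Y = {} then \<zero>\<^bsub>R\<^esub> else \<one>\<^bsub>R\<^esub>)"
    by (simp_all add: simps)
  show "st_res (induced_structure T R F U Y) v u =
       {(s, t). U u \<subseteq> U v \<and> s \<in> sections_on Y v \<and> t = (if U u \<inter> Y = {} then \<zero>\<^bsub>R\<^esub> else s)}"
    by (auto simp: simps)
  show "st_to (induced_structure T R F U Y) = {(x, y). x \<in> Y \<and> y = x}"
    by (auto simp: simps inclusion_map_def)
  show "st_from (induced_structure T R F U Y) u =
       {(s, t). s \<in> ambient_sections u \<and> t = (if U u \<inter> Y = {} then \<zero>\<^bsub>R\<^esub> else s)}"
    by (auto simp: simps inclusion_map_def)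
qed

section \<open>Relations decidable from the ambient diagram\<close>

lemma decidable_in_space_diagram:
  "computable_in G f \<Longrightarrow> decidable_in G (\<lambda>z. f z \<in> space_diagram)"
  using computable_set_decidable_in computable_Z decidable_in_compose
  unfolding computable_structure_def by blast

lemma decidable_in_U:
  assumes "computable_in G f" "computable_in G f'"
  shows "decidable_in G (\<lambda>z. f z \<in> U (f' z))"
proof -
  have "decidable_in G (\<lambda>z. list_encode [1, f' z, f z] \<in> space_diagram)"
    by (intro computability decidable_in_space_diagram assms)
  then show ?thesis unfolding list_encode_mem_atomic_diagram ambient_structure_simps .
qed

lemma decidable_in_U_subset:
  assumes "computable_in G f" "computable_in G f'"
  shows "decidable_in G (\<lambda>z. U (f z) \<subseteq> U (f' z))"
proof -
  have "decidable_in G (\<lambda>z. list_encode [7, f' z, f z, \<zero>\<^bsub>R\<^esub>, \<zero>\<^bsub>R\<^esub>] \<in> space_diagram)"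
    by (intro computability decidable_in_space_diagram assms)
  then show ?thesis unfolding list_encode_mem_atomic_diagram ambient_structure_simps .
qed

lemma decidable_in_ambient_sections:
  assumes "computable_in G f" "computable_in G f'"
  shows "decidable_in G (\<lambda>z. f z \<in> ambient_sections (f' z))"
proof -
  have "decidable_in G (\<lambda>z. list_encode [2, f' z, f z] \<in> space_diagram)"
    by (intro computability decidable_in_space_diagram assms)
  then show ?thesis unfolding list_encode_mem_atomic_diagram ambient_structure_simps .
qed

text \<open>In a nontrivial \<open>R\<close> the unit over \<open>U u\<close> is zero only for the
  empty set, so the atomic sentence about the unit tests emptiness.\<close>

lemma decidable_in_U_empty:
  assumes "\<one>\<^bsub>R\<^esub> \<noteq> \<zero>\<^bsub>R\<^esub>"
  shows "decidable_in G (\<lambda>u. U u = {})"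
proof -
  have "decidable_in G (\<lambda>u. list_encode [6, u, \<zero>\<^bsub>R\<^esub>] \<in> space_diagram)"
    by (intro computability decidable_in_space_diagram)
  moreover have "\<zero>\<^bsub>R\<^esub> = (if U u = {} then \<zero>\<^bsub>R\<^esub> else \<one>\<^bsub>R\<^esub>) \<longleftrightarrow> U u = {}" for u
    using assms by auto
  ultimately show ?thesis
    unfolding list_encode_mem_atomic_diagram ambient_structure_simps by simp
qed

text \<open>Witness codes make the domains of the copy decidable. The other relations are decided on
  first components with the help of the ambient diagram, except that units and restrictions depend
  on whether \<open>U u\<close> misses \<open>Y\<close>. If \<open>R\<close> is trivial all sections
  are zero and the question is void, hence the conditional form of \<open>empty\<close>.\<close>

lemma copy_decidable_from_witnesses:
  assumes Y: "Y \<subseteq> topspace T"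
    and P: "decidable_in G (\<lambda>z. P (pfst z) (psnd z))" "\<And>x. x \<in> Y \<longleftrightarrow> (\<exists>k. P x k)"
    and Q: "decidable_in G (\<lambda>z. Q (pfst z) (pfst (psnd z)) (psnd (psnd z)))"
      "\<And>u s. s \<in> sections_on Y u \<longleftrightarrow> (\<exists>k. Q u s k)"
    and empty: "\<one>\<^bsub>R\<^esub> \<noteq> \<zero>\<^bsub>R\<^esub> \<Longrightarrow> decidable_in G (\<lambda>u. U u \<inter> Y = {})"
  obtains \<B> where "structure_iso (induced_structure T R F U Y) \<B>"
    "decidable_in G (\<lambda>n. n \<in> atomic_diagram \<B>)"
proof
  define h where "h = witness_code P"
  define k where "k u = witness_code (Q u)" for u
  define point where "point = is_witness_code P"
  define sect where "sect u = is_witness_code (Q u)" for u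
  \<comment> \<open>The first conjunct makes \<open>E\<close> decidable in the trivial case too,
    where both branches of \<open>if_E\<close> agree anyway.\<close>
  define E where "E u \<longleftrightarrow> \<one>\<^bsub>R\<^esub> \<noteq> \<zero>\<^bsub>R\<^esub> \<and> U u \<inter> Y = {}" for u
  let ?\<B> = "recoded h k (induced_structure T R F U Y)"
  show "structure_iso (induced_structure T R F U Y) ?\<B>"
    by (rule structure_iso_recoded) (simp_all add: h_def k_def)
  have dec_point: "decidable_in G (\<lambda>z. point (f z))" if "computable_in G f" for f
  proof -
    have "decidable_in G (\<lambda>z. P (pfst (psnd z)) (psnd (psnd z)))"
      by (rule decidable_in_compose2[OF P(1)]) (intro computability)+
    from decidable_in_is_witness_code[where Q="\<lambda>_. P", OF this computable_in_id that]
    show ?thesis by (simp add: point_def)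
  qed
  have dec_sect: "decidable_in G (\<lambda>z. sect (f z) (f' z))"
    if "computable_in G f" "computable_in G f'" for f f'
    unfolding sect_def by (rule decidable_in_is_witness_code[OF Q(1) that])
  have dec_E: "decidable_in G (\<lambda>z. E (f z))" if "computable_in G f" for f
  proof (cases "\<one>\<^bsub>R\<^esub> = \<zero>\<^bsub>R\<^esub>")
    case False
    then show ?thesis using decidable_in_compose[OF empty that] by (simp add: E_def)
  qed (simp add: E_def decidable_in_const)
  have if_E: "(if U u \<inter> Y = {} then \<zero>\<^bsub>R\<^esub> else a) = (if E u then \<zero>\<^bsub>R\<^esub> else a)"
    if "a \<in> carrier R" for a u
  proof (cases "\<one>\<^bsub>R\<^esub> = \<zero>\<^bsub>R\<^esub>")
    case True
    then show ?thesis using R.one_zeroD that by auto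
  qed (simp add: E_def)
  have h_iff: "n \<in> h ` X \<longleftrightarrow> point n \<and> pfst n \<in> X" if "X \<subseteq> Y" for n X
    unfolding h_def point_def using that P(2) by (intro image_witness_code) blast
  have point_Y: "point n \<Longrightarrow> pfst n \<in> Y" for n
    using P(2) by (auto simp: point_def is_witness_code_iff)
  have k_eq: "n = k u s \<longleftrightarrow> sect u n \<and> pfst n = s" if "s \<in> sections_on Y u" for n u s
    using that Q(2) unfolding k_def sect_def by (intro eq_witness_code_iff) blast
  have sect_mem: "sect u n \<Longrightarrow> pfst n \<in> sections_on Y u" for u n
    using Q(2) by (auto simp: sect_def is_witness_code_iff)
  have k_image: "n \<in> k u ` sections_on Y u \<longleftrightarrow> sect u n" for n u
    using k_eq sect_mem by blast
  \<comment> \<open>A search for an ambient open set over which both decoded sections live. The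
    implication makes it halt also on arguments that are not codes of two sections.\<close>
  define W where "W z = (LEAST w. sect (pfst z) (pfst (psnd z)) \<and> sect (pfst z) (psnd (psnd z)) \<longrightarrow>
      pfst (pfst (psnd z)) \<in> ambient_sections w \<and> pfst (psnd (psnd z)) \<in> ambient_sections w)" for z
  have W_ex: "\<exists>w. sect (pfst z) (pfst (psnd z)) \<and> sect (pfst z) (psnd (psnd z)) \<longrightarrow>
      pfst (pfst (psnd z)) \<in> ambient_sections w \<and> pfst (psnd (psnd z)) \<in> ambient_sections w" for z
    using sections_on_common sect_mem by metis
  have W_computable: "computable_in G W"
    unfolding W_def by (intro computability dec_sect decidable_in_ambient_sections W_ex)
  have W: "pfst s \<in> ambient_sections (W (prod_encode (u, prod_encode (s, t))))"
    "pfst t \<in> ambient_sections (W (prod_encode (u, prod_encode (s, t))))"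
    if "sect u s" "sect u t" for u s t
    using LeastI_ex[OF W_ex[of "prod_encode (u, prod_encode (s, t))"]] that
    unfolding W_def[symmetric] by auto
  note simps = induced_structure_simps[OF Y]
  \<comment> \<open>The sum is read off the ambient ring over \<open>W\<close>;
    \<open>sect u r\<close> requires \<open>r\<close> to carry its own least witness.\<close>
  have add_iff: "s \<in> carrier (st_ring ?\<B> u) \<and> t \<in> carrier (st_ring ?\<B> u) \<and> r = s \<oplus>\<^bsub>st_ring ?\<B> u\<^esub> t \<longleftrightarrow>
      sect u s \<and> sect u t \<and> sect u r \<and>
      list_encode [3, W (prod_encode (u, prod_encode (s, t))), pfst s, pfst t, pfst r] \<in> space_diagram"
    for u s t r
  proof (cases "sect u s \<and> sect u t")
    case True
    then have "pfst s \<oplus>\<^bsub>R\<^esub> pfst t \<in> sections_on Y u"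
      using sections_on_common sect_mem by (metis subsetD)
    from k_eq[OF this] show ?thesis
      unfolding list_encode_mem_atomic_diagram ambient_structure_simps
      using True W by (simp add: recoded_def simps k_image)
  qed (auto simp: recoded_def simps k_image)
  have mult_iff: "s \<in> carrier (st_ring ?\<B> u) \<and> t \<in> carrier (st_ring ?\<B> u) \<and> r = s \<otimes>\<^bsub>st_ring ?\<B> u\<^esub> t \<longleftrightarrow>
      sect u s \<and> sect u t \<and> sect u r \<and>
      list_encode [4, W (prod_encode (u, prod_encode (s, t))), pfst s, pfst t, pfst r] \<in> space_diagram"
    for u s t r
  proof (cases "sect u s \<and> sect u t")
    case True
    then have "pfst s \<otimes>\<^bsub>R\<^esub> pfst t \<in> sections_on Y u"
      using sections_on_common sect_mem by (metis subsetD)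
    from k_eq[OF this] show ?thesis
      unfolding list_encode_mem_atomic_diagram ambient_structure_simps
      using True W by (simp add: recoded_def simps k_image)
  qed (auto simp: recoded_def simps k_image)
  have zero_iff: "r = \<zero>\<^bsub>st_ring ?\<B> u\<^esub> \<longleftrightarrow> sect u r \<and> pfst r = \<zero>\<^bsub>R\<^esub>" for r u
    using k_eq[OF zero_mem_sections_on] by (simp add: recoded_def simps)
  have one_iff: "r = \<one>\<^bsub>st_ring ?\<B> u\<^esub> \<longleftrightarrow> sect u r \<and> pfst r = (if E u then \<zero>\<^bsub>R\<^esub> else \<one>\<^bsub>R\<^esub>)" for r u
  proof -
    have "(if U u \<inter> Y = {} then \<zero>\<^bsub>R\<^esub> else \<one>\<^bsub>R\<^esub>) \<in> sections_on Y u"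
      using zero_mem_sections_on one_mem_sections_on by simp
    from k_eq[OF this] show ?thesis
      by (simp add: recoded_def simps if_E[symmetric])
  qed
  have res_iff: "(s, t) \<in> st_res ?\<B> v u \<longleftrightarrow>
      U u \<subseteq> U v \<and> sect v s \<and> sect u t \<and> pfst t = (if E u then \<zero>\<^bsub>R\<^esub> else pfst s)" for s t v u
  proof -
    have mem: "(if U u \<inter> Y = {} then \<zero>\<^bsub>R\<^esub> else a) \<in> sections_on Y u"
      if "U u \<subseteq> U v" "a \<in> sections_on Y v" for a
      using that zero_mem_sections_on sections_on_antimono[OF that(1), of Y]
      by (cases "U u \<inter> Y = {}") auto
    have "(s, t) \<in> st_res ?\<B> v u \<longleftrightarrow> (\<exists>a. U u \<subseteq> U v \<and> a \<in> sections_on Y v \<and> s = k v a \<and>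
        t = k u (if U u \<inter> Y = {} then \<zero>\<^bsub>R\<^esub> else a))"
      by (auto simp add: recoded_def simps mem_map_prod_image simp del: split_paired_Ex)
    also have "\<dots> \<longleftrightarrow> (\<exists>a. U u \<subseteq> U v \<and> a \<in> sections_on Y v \<and> (sect v s \<and> pfst s = a) \<and>
        sect u t \<and> pfst t = (if E u then \<zero>\<^bsub>R\<^esub> else a))"
    proof (intro ex_cong1 conj_cong refl)
      fix a assume a: "U u \<subseteq> U v" "a \<in> sections_on Y v"
      show "s = k v a \<longleftrightarrow> sect v s \<and> pfst s = a" by (rule k_eq[OF a(2)])
      have "a \<in> carrier R" using a(2) sections_on_subset_carrier by blast
      from k_eq[OF mem[OF a], of t, unfolded if_E[OF this]]
      show "t = k u (if U u \<inter> Y = {} then \<zero>\<^bsub>R\<^esub> else a) \<longleftrightarrow>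
          sect u t \<and> pfst t = (if E u then \<zero>\<^bsub>R\<^esub> else a)"
        unfolding if_E[OF \<open>a \<in> carrier R\<close>] .
    qed
    finally show ?thesis using sect_mem by blast
  qed
  have to_iff: "(x, y) \<in> st_to ?\<B> \<longleftrightarrow> point x \<and> y = pfst x" for x y
  proof -
    have "(x, y) \<in> st_to ?\<B> \<longleftrightarrow> y \<in> Y \<and> x = h y"
      by (auto simp: recoded_def simps mem_map_prod_image)
    also have "\<dots> \<longleftrightarrow> point x \<and> y = pfst x"
      using h_iff[of Y x] point_Y[of x] by (auto simp: h_def)
    finally show ?thesis .
  qed
  have from_iff: "(r, s) \<in> st_from ?\<B> u \<longleftrightarrow>
      r \<in> ambient_sections u \<and> sect u s \<and> pfst s = (if E u then \<zero>\<^bsub>R\<^esub> else r)" for r s u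
  proof -
    have mem: "(if U u \<inter> Y = {} then \<zero>\<^bsub>R\<^esub> else r) \<in> sections_on Y u" if "r \<in> ambient_sections u"
      using that zero_mem_sections_on ambient_sections_subset_sections_on[of u Y]
      by (cases "U u \<inter> Y = {}") auto
    have "(r, s) \<in> st_from ?\<B> u \<longleftrightarrow>
        r \<in> ambient_sections u \<and> s = k u (if U u \<inter> Y = {} then \<zero>\<^bsub>R\<^esub> else r)"
      by (auto simp add: recoded_def simps mem_map_prod_image simp del: split_paired_Ex)
    also have "\<dots> \<longleftrightarrow>
        r \<in> ambient_sections u \<and> sect u s \<and> pfst s = (if E u then \<zero>\<^bsub>R\<^esub> else r)"
    proof (intro conj_cong refl)
      assume r: "r \<in> ambient_sections u"
      then have "r \<in> carrier R" using ambient_sections_subset_carrier by blast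
      from k_eq[OF mem[OF r], of s, unfolded if_E[OF this]]
      show "s = k u (if U u \<inter> Y = {} then \<zero>\<^bsub>R\<^esub> else r) \<longleftrightarrow>
          sect u s \<and> pfst s = (if E u then \<zero>\<^bsub>R\<^esub> else r)"
        unfolding if_E[OF \<open>r \<in> carrier R\<close>] .
    qed
    finally show ?thesis .
  qed
  have points: "st_points ?\<B> = {x. point x}"
    using h_iff[OF subset_refl] point_Y by (auto simp only: recoded_def simps rs_structure.select_convs)
  have opens: "st_open ?\<B> u = {x. point x \<and> pfst x \<in> U u}" for u
    using h_iff[OF Int_lower2, of _ "U u"] point_Y
    by (auto simp only: recoded_def simps rs_structure.select_convs)
  have carrier: "carrier (st_ring ?\<B> u) = {s. sect u s}" for u
    by (simp add: recoded_def simps set_eq_iff k_image)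
  note ints = computability dec_point dec_sect dec_E decidable_in_U decidable_in_U_subset
    decidable_in_ambient_sections decidable_in_space_diagram computable_in_compose[OF W_computable]
  show "decidable_in G (\<lambda>n. n \<in> atomic_diagram ?\<B>)"
  proof (rule decidable_in_atomic_diagram, goal_cases)
    case 1 show ?case unfolding points mem_Collect_eq by (intro ints)
  next
    case 2 show ?case unfolding opens mem_Collect_eq by (intro ints)
  next
    case 3 show ?case unfolding carrier mem_Collect_eq by (intro ints)
  next
    case 4 show ?case unfolding add_iff by (intro ints)
  next
    case 5 show ?case unfolding mult_iff by (intro ints)
  next
    case 6 show ?case unfolding zero_iff by (intro ints)
  next
    case 7 show ?case unfolding one_iff by (intro ints)
  next
    case 8 show ?case unfolding res_iff by (intro ints)
  next
    case 9 show ?case unfolding to_iff by (intro ints)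
  next
    case 10 show ?case unfolding from_iff by (intro ints)
  qed
qed

end


section \<open>Degrees of isomorphism types\<close>

lemma turing_degree_cong: "turing_le X Y \<Longrightarrow> turing_le Y X \<Longrightarrow> turing_degree X = turing_degree Y"
  unfolding turing_degree_def using turing_le_trans by blast

text \<open>\<open>degree_le\<close> does not depend on representatives, so a least degree amounts
  to one copy reducible to all others.\<close>

lemma iso_type_has_degree_least:
  assumes "iso_type_has_degree \<A> d" "d \<in> turing_degrees"
  obtains \<B> where "structure_iso \<A> \<B>"
    "\<And>\<C>. structure_iso \<A> \<C> \<Longrightarrow> turing_le (atomic_diagram \<B>) (atomic_diagram \<C>)"
proof -
  obtain \<B> where \<B>: "structure_iso \<A> \<B>" "turing_degree (atomic_diagram \<B>) = d"
    using assms by (auto simp: iso_type_has_degree_def)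
  have "turing_le (atomic_diagram \<B>) (atomic_diagram \<C>)" if \<C>: "structure_iso \<A> \<C>" for \<C>
  proof -
    have "degree_le d (turing_degree (atomic_diagram \<C>))"
      using assms(1) \<C> by (simp add: iso_type_has_degree_def)
    then show ?thesis
      unfolding degree_le_def \<B>(2)[symmetric] turing_degree_def
      by (auto intro: turing_le_trans)
  qed
  then show ?thesis using that \<B>(1) by blast
qed

context coded_ringed_space
begin

section \<open>Coded subsets and copies computed from enumerations\<close>

lemma ZX_subset:
  assumes "X \<subseteq> {0<..}"
  shows "ZX X \<subseteq> topspace T"
proof -
  have "e n \<in> topspace T" if "n \<in> X" for n
    using bij_betwE[OF e_enum] assms that by auto
  then show ?thesis using A_sub B_sub by (auto simp: coded_subset_def)
qed

lemma e_mem_ZX_iff: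
  assumes "X \<subseteq> {0<..}" "0 < n"
  shows "e n \<in> ZX X \<longleftrightarrow> n \<in> X"
proof -
  have "e n \<notin> A \<union> B" using e_enum assms(2) by (auto simp: bij_betw_def)
  moreover have "e n = e m \<longleftrightarrow> n = m" if "m \<in> X" for m
    using bij_betw_imp_inj_on[OF e_enum] assms that by (auto simp: inj_on_def)
  ultimately show ?thesis by (auto simp: coded_subset_def)
qed

lemma ZX_subset_ZX_iff:
  assumes "M \<subseteq> {0<..}" "N \<subseteq> {0<..}"
  shows "ZX M \<subseteq> ZX N \<longleftrightarrow> M \<subseteq> N"
proof
  assume sub: "ZX M \<subseteq> ZX N"
  show "M \<subseteq> N"
  proof
    fix n assume n: "n \<in> M"
    then have "e n \<in> ZX N" using sub by (auto simp: coded_subset_def)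
    then show "n \<in> N" using n assms e_mem_ZX_iff by auto
  qed
qed (auto simp: coded_subset_def)

text \<open>The given program is run with the zero oracle; replacing its queries by
  \<open>Zero\<close> makes it correct for every oracle.\<close>

lemma e_program: obtains p where "\<And>g n. 0 < n \<Longrightarrow> rec_eval g p [n] (e n)"
proof -
  obtain q where "\<forall>n\<in>{0<..}. rec_eval (\<lambda>_. 0) q [n] (e n)"
    using e_computable by (auto simp: computable_fun_on_def)
  then have "rec_eval g (subst_query Zero q) [n] (e n)" if "0 < n" for g n
    using rec_eval_subst_query[OF rec_eval.zero] that by simp
  then show ?thesis using that by blast
qed

text \<open>\<open>computable_in\<close> asks for totality, but \<open>e\<close> is computable only
  at positive arguments; the successor keeps the argument positive.\<close>

lemma computable_in_e_Suc:
  assumes "computable_in G f"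
  shows "computable_in G (\<lambda>z. e (Suc (f z)))"
proof -
  obtain p where "\<And>g n. 0 < n \<Longrightarrow> rec_eval g p [n] (e n)" using e_program by blast
  moreover obtain q where "\<forall>g\<in>G. \<forall>n. rec_eval g q [n] (Suc (f n))"
    using computable_in_Suc[OF assms] by (auto simp: computable_in_def)
  ultimately have "\<forall>g\<in>G. \<forall>n. rec_eval g (Comp p [q]) [n] (e (Suc (f n)))"
    using rec_eval_Comp1 by blast
  then show ?thesis by (auto simp: computable_in_def)
qed

lemma copy_decidable_from_enumeration:
  assumes S: "S \<subseteq> {0<..}" and g: "enumerates g S"
    and empty: "\<one>\<^bsub>R\<^esub> \<noteq> \<zero>\<^bsub>R\<^esub> \<Longrightarrow> decidable_in {g} (\<lambda>u. U u \<inter> ZX S = {})"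
  obtains \<B> where "structure_iso (induced_structure T R F U (ZX S)) \<B>"
    "decidable_in {g} (\<lambda>n. n \<in> atomic_diagram \<B>)"
proof -
  obtain p where "\<And>g. enumerates g S \<Longrightarrow> \<exists>h. (\<forall>k. rec_eval g p [k] (h k)) \<and>
      enumerates h (section_set T R F U (ZX S))"
    using le_e[OF S] unfolding enum_le_def by blast
  from this[OF g] obtain h where h: "computable_in {g} h" "enumerates h (section_set T R F U (ZX S))"
    by (auto simp: computable_in_def)
  note g_comp = computable_in_compose[OF computable_in_oracle[of g]]
  \<comment> \<open>The output at step \<open>k\<close> is \<open>g k - 1\<close>. For
    \<open>2 \<le> g k\<close> it is positive and equals \<open>Suc (g k - 2)\<close>, the form in
    which \<open>e\<close> may be applied.\<close>
  define P where "P x k \<longleftrightarrow> x \<in> A \<or> x \<in> B \<or> (2 \<le> g k \<and> x = e (Suc (g k - 2)))" for x k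
  show ?thesis
  proof (rule copy_decidable_from_witnesses[where Y="ZX S" and G="{g}" and P=P
        and Q="\<lambda>u s k. h k = Suc (prod_encode (u, s))"])
    show "decidable_in {g} (\<lambda>z. P (pfst z) (psnd z))"
      unfolding P_def
      by (intro computability computable_in_e_Suc g_comp
          decidable_in_compose[OF computable_set_decidable_in[OF A_computable]]
          decidable_in_compose[OF computable_set_decidable_in[OF B_computable]])
    show "decidable_in {g} (\<lambda>z. h (psnd (psnd z)) = Suc (prod_encode (pfst z, pfst (psnd z))))"
      by (intro computability computable_in_compose[OF h(1)])
    show "x \<in> ZX S \<longleftrightarrow> (\<exists>k. P x k)" for x
    proof -
      have "(\<exists>n\<in>S. x = e n) \<longleftrightarrow> (\<exists>k. 2 \<le> g k \<and> x = e (Suc (g k - 2)))"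
      proof
        assume "\<exists>n\<in>S. x = e n"
        then obtain n k where n: "n \<in> S" "x = e n" "g k = Suc n"
          using g by (auto simp: enumerates_def)
        moreover have "0 < n" using n S by auto
        ultimately have "2 \<le> g k \<and> x = e (Suc (g k - 2))" by (simp add: numeral_2_eq_2)
        then show "\<exists>k. 2 \<le> g k \<and> x = e (Suc (g k - 2))" ..
      next
        assume "\<exists>k. 2 \<le> g k \<and> x = e (Suc (g k - 2))"
        then obtain k where k: "2 \<le> g k" "x = e (Suc (g k - 2))" by blast
        then have "g k = Suc (Suc (g k - 2))" by simp
        then have "Suc (g k - 2) \<in> S" using g unfolding enumerates_def by blast
        then show "\<exists>n\<in>S. x = e n" using k by blast
      qed
      then show ?thesis by (auto simp: coded_subset_def P_def)
    qed
    show "s \<in> sections_on (ZX S) u \<longleftrightarrow> (\<exists>k. h k = Suc (prod_encode (u, s)))" for u s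
    proof -
      have "s \<in> sections_on (ZX S) u \<longleftrightarrow> prod_encode (u, s) \<in> section_set T R F U (ZX S)"
        by (auto simp: section_set_def sections_on_def)
      then show ?thesis using h(2) by (auto simp: enumerates_def)
    qed
  qed (use ZX_subset[OF S] empty that in auto)
qed

lemma mem_iff_copy:
  assumes "S \<subseteq> {0<..}" "structure_iso (induced_structure T R F U (ZX S)) \<B>" "0 < n"
  shows "n \<in> S \<longleftrightarrow> (\<exists>x. list_encode [8, x, e n] \<in> atomic_diagram \<B>)"
proof -
  obtain h where "st_to \<B> = map_prod h id ` st_to (induced_structure T R F U (ZX S))"
    using assms(2) by (auto simp: structure_iso_def)
  then have "(\<exists>x. (x, e n) \<in> st_to \<B>) \<longleftrightarrow> e n \<in> ZX S"
    by (auto simp: induced_structure_simps[OF ZX_subset[OF assms(1)]] image_iff)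
  then show ?thesis
    unfolding list_encode_mem_atomic_diagram using e_mem_ZX_iff[OF assms(1,3)] by simp
qed

section \<open>Isomorphism types of every degree\<close>

lemma ex_iso_type_has_degree:
  "\<exists>S\<subseteq>{0<..}. iso_type_has_degree (induced_structure T R F U (ZX S)) (turing_degree X)"
proof -
  \<comment> \<open>The tags 0 and 1 mark members and nonmembers of \<open>X\<close>; the shift by
    one keeps the codes positive.\<close>
  define S where "S = {m. 0 < m \<and> (pfst (m - 1) = 0 \<and> psnd (m - 1) \<in> X \<or>
      pfst (m - 1) = 1 \<and> psnd (m - 1) \<notin> X)}"
  have S: "S \<subseteq> {0<..}" by (auto simp: S_def)
  have pos: "Suc (prod_encode (0, n)) \<in> S \<longleftrightarrow> n \<in> X"
    and neg: "Suc (prod_encode (1, n)) \<in> S \<longleftrightarrow> n \<notin> X" for n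
    by (simp_all add: S_def)
  have X_mem: "decidable_in {char_fun X} (\<lambda>z. f z \<in> X)" if "computable_in {char_fun X} f" for f
    using decidable_in_compose[OF turing_le_refl[of X, unfolded turing_le_iff_decidable] that] .
  have S_X: "decidable_in {char_fun X} (\<lambda>m. m \<in> S)"
    unfolding S_def mem_Collect_eq by (intro computability X_mem)
  \<comment> \<open>Listing \<open>k\<close> at step \<open>k\<close> makes the support of
    \<open>g\<close> equal to \<open>S\<close>, so this enumeration also decides
    \<open>S\<close>.\<close>
  define g where "g k = (if k \<in> S then Suc k else 0)" for k
  have g: "enumerates g S" by (auto simp: enumerates_def g_def)
  have g_X: "computable_in {char_fun X} g"
    unfolding g_def by (intro computability S_X)
  have "decidable_in {g} (\<lambda>k. g k \<noteq> 0)"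
    by (intro computability computable_in_oracle)
  moreover have "g k \<noteq> 0 \<longleftrightarrow> k \<in> S" for k by (simp add: g_def)
  ultimately have S_g: "computable_in {g} (char_fun S)"
    by (simp only: decidable_in_def char_fun_of_bool)
  have "decidable_in {g} (\<lambda>u. U u \<inter> ZX S = {})" if "\<one>\<^bsub>R\<^esub> \<noteq> \<zero>\<^bsub>R\<^esub>"
  proof -
    have "decidable_in {g} (\<lambda>n. n \<in> section_set T R F U (ZX S))"
      by (rule decidable_in_trans[OF le_T[OF S, unfolded turing_le_iff_decidable] S_g])
    note section_mem = decidable_in_compose[OF this]
    have "decidable_in {g} (\<lambda>u. prod_encode (u, \<one>\<^bsub>R\<^esub>) \<notin> section_set T R F U (ZX S))"
      by (intro computability section_mem)
    moreover have "prod_encode (u, \<one>\<^bsub>R\<^esub>) \<in> section_set T R F U (ZX S) \<longleftrightarrow> \<one>\<^bsub>R\<^esub> \<in> sections_on (ZX S) u" for u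
      by (auto simp: section_set_def sections_on_def)
    moreover have "\<one>\<^bsub>R\<^esub> \<notin> sections_on (ZX S) u \<longleftrightarrow> U u \<inter> ZX S = {}" for u
      using one_mem_sections_on[of u "ZX S"] that by (auto simp: sections_on_eq)
    ultimately show ?thesis by simp
  qed
  then obtain \<B> where \<B>: "structure_iso (induced_structure T R F U (ZX S)) \<B>"
    "decidable_in {g} (\<lambda>n. n \<in> atomic_diagram \<B>)"
    using copy_decidable_from_enumeration[OF S g] by blast
  have B_X: "turing_le (atomic_diagram \<B>) X"
    unfolding turing_le_iff_decidable by (rule decidable_in_trans[OF \<B>(2) g_X])
  have X_le: "turing_le X (atomic_diagram \<C>)"
    if \<C>: "structure_iso (induced_structure T R F U (ZX S)) \<C>" for \<C>
  proof -
    let ?c = "\<lambda>i n x. list_encode [8, x, e (Suc (prod_encode (i, n)))] \<in> atomic_diagram \<C>"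
    let ?g = "char_fun (atomic_diagram \<C>)"
    have mem: "decidable_in {?g} (\<lambda>z. f z \<in> atomic_diagram \<C>)" if "computable_in {?g} f" for f
      using decidable_in_compose[OF turing_le_refl[of "atomic_diagram \<C>",
            unfolded turing_le_iff_decidable] that] .
    have pos': "n \<in> X \<longleftrightarrow> (\<exists>x. ?c 0 n x)" for n
      using mem_iff_copy[OF S \<C>, of "Suc (prod_encode (0, n))"] pos by simp
    have neg': "n \<notin> X \<longleftrightarrow> (\<exists>x. ?c 1 n x)" for n
      using mem_iff_copy[OF S \<C>, of "Suc (prod_encode (1, n))"] neg by simp
    \<comment> \<open>Exactly one of the two codes of \<open>n\<close> lies in \<open>S\<close>, so
      a search for a point over either of them halts and tells which.\<close>
    have ex: "\<exists>x. ?c 0 n x \<or> ?c 1 n x" for n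
      using pos' neg' by blast
    have "decidable_in {?g} (\<lambda>n. ?c 0 n (LEAST x. ?c 0 n x \<or> ?c 1 n x))"
      by (intro computability computable_in_e_Suc mem ex)
    moreover have "?c 0 n (LEAST x. ?c 0 n x \<or> ?c 1 n x) \<longleftrightarrow> n \<in> X" for n
      using LeastI_ex[OF ex[of n]] pos' neg' by blast
    ultimately show ?thesis by (simp only: turing_le_iff_decidable)
  qed
  have "iso_type_has_degree (induced_structure T R F U (ZX S)) (turing_degree X)"
    unfolding iso_type_has_degree_def
  proof (intro conjI allI impI)
    show "\<exists>\<B>. structure_iso (induced_structure T R F U (ZX S)) \<B> \<and>
        turing_degree (atomic_diagram \<B>) = turing_degree X"
      using \<B>(1) turing_degree_cong[OF B_X X_le] by blast
    show "degree_le (turing_degree X) (turing_degree (atomic_diagram \<C>))"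
      if "structure_iso (induced_structure T R F U (ZX S)) \<C>" for \<C>
      using X_le[OF that] turing_le_refl by (auto simp: degree_le_def turing_degree_def)
  qed
  then show ?thesis using S by blast
qed

section \<open>An isomorphism type without a degree\<close>

text \<open>Nonempty open sets of an irreducible space meet. A finite one of least size would
  therefore be contained in all of them, contrary to \<open>A_empty\<close>.\<close>

lemma open_infinite:
  assumes A: "A = {}" and V: "openin T V" "V \<noteq> {}"
  shows "infinite V"
proof
  assume "finite V"
  define W where "W = (ARG_MIN card W. openin T W \<and> W \<noteq> {} \<and> finite W)"
  have W: "openin T W \<and> W \<noteq> {} \<and> finite W"
    unfolding W_def by (rule arg_min_natI[of _ V]) (use V \<open>finite V\<close> in auto)
  have W_le: "card W \<le> card W'" if "openin T W' \<and> W' \<noteq> {} \<and> finite W'" for W'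
    unfolding W_def by (rule arg_min_nat_le) (use that in auto)
  have irreducible: "irreducible_space T"
    using elements by (simp add: ringed_space_of_elements_def)
  have "W \<subseteq> W'" if W': "openin T W'" "W' \<noteq> {}" for W'
  proof -
    have "W' \<inter> W \<noteq> {}"
    proof
      assume "W' \<inter> W = {}"
      then have "(topspace T - W') \<union> (topspace T - W) = topspace T" by blast
      moreover have "topspace T - W' \<noteq> topspace T" "topspace T - W \<noteq> topspace T"
        using W W' openin_subset by blast+
      moreover have "closedin T (topspace T - W')" "closedin T (topspace T - W)"
        using W W' by auto
      ultimately show False
        using irreducible unfolding irreducible_space_def by metis
    qed
    then have "card W \<le> card (W' \<inter> W)" using W W' by (intro W_le) auto
    then have "W' \<inter> W = W" using W by (intro card_seteq) auto
    then show ?thesis by blast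
  qed
  then show False using A_empty[OF A] W by blast
qed

lemma ex_iso_type_no_degree:
  "\<exists>S\<subseteq>{0<..}. \<not> (\<exists>d\<in>turing_degrees. iso_type_has_degree (induced_structure T R F U (ZX S)) d)"
proof (rule ccontr)
  assume contra: "\<not> ?thesis"
  \<comment> \<open>Only open sets that neither \<open>A\<close> nor \<open>B\<close> is known to
    meet impose a condition; for the others any index will do.\<close>
  define I where "I u = (if A = {} \<and> U u \<noteq> {} \<and> U u \<inter> B = {} then {n. 0 < n \<and> e n \<in> U u} else UNIV)" for u
  have "infinite (I u)" for u
  proof (cases "A = {} \<and> U u \<noteq> {} \<and> U u \<inter> B = {}")
    case True
    have "U u \<subseteq> e ` I u"
    proof
      fix y assume y: "y \<in> U u"
      then have "y \<in> e ` {0<..}"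
        unfolding bij_betw_imp_surj_on[OF e_enum] using True U_subset[of u] by blast
      then show "y \<in> e ` I u" using y True by (auto simp: I_def)
    qed
    moreover have "infinite (U u)" using True open_infinite openin_U by blast
    ultimately show ?thesis using finite_surj by blast
  next
    case False
    then show ?thesis unfolding I_def by (simp only: if_False infinite_UNIV_nat not_False_eq_True)
  qed
  then obtain x where x: "\<And>u. x u \<in> I u" "\<And>k. Suc (x k) < x (Suc k)"
    using infinite_sets_sparse_transversal by metis
  have "strict_mono x" using x(2) by (intro strict_mono_Suc_iff[THEN iffD2]) (meson Suc_lessD)
  then have x_less: "x i < x j \<longleftrightarrow> i < j" for i j by (rule strict_mono_less)
  have x_gap: "Suc (x k) \<noteq> x j" for k j
    using x(2)[of k] x_less[of k j] x_less[of j "Suc k"] by (metis lessI less_irrefl not_less_eq)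
  \<comment> \<open>The transversal is common to all \<open>r\<close>, and \<open>Suc (x k)\<close>
    records whether the rational numbered \<open>k\<close> lies below \<open>r\<close>. Intersecting
    with the positive numbers matters because an unconstrained \<open>x u\<close> may be 0.\<close>
  define S where "S r = (range x \<inter> {0<..}) \<union> {Suc (x k) |k. real_of_rat (from_nat k) < r}" for r
  have S: "S r \<subseteq> {0<..}" for r by (auto simp: S_def)
  have meets: "U u \<inter> ZX (S r) = {} \<longleftrightarrow> U u = {}" for u r
  proof (cases "A = {} \<and> U u \<noteq> {} \<and> U u \<inter> B = {}")
    case True
    then have "x u \<in> S r" "e (x u) \<in> U u"
      using x(1)[of u] by (auto simp: I_def S_def)
    then show ?thesis by (auto simp: coded_subset_def)
  next
    case False
    then show ?thesis using A_common[OF openin_U[of u]] by (auto simp: coded_subset_def)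
  qed
  have copy: "\<exists>\<B>. structure_iso (induced_structure T R F U (ZX (S r))) \<B> \<and>
      decidable_in {g} (\<lambda>n. n \<in> atomic_diagram \<B>)" if "enumerates g (S r)" for g r
    using copy_decidable_from_enumeration[OF S that] decidable_in_U_empty by (auto simp: meets)
  have "\<exists>\<B>. structure_iso (induced_structure T R F U (ZX (S r))) \<B> \<and>
     (\<forall>\<C>. structure_iso (induced_structure T R F U (ZX (S r))) \<C> \<longrightarrow>
        turing_le (atomic_diagram \<B>) (atomic_diagram \<C>))" for r
    using contra S[of r] iso_type_has_degree_least by metis
  then obtain \<B> where \<B>: "\<And>r. structure_iso (induced_structure T R F U (ZX (S r))) (\<B> r)"
    "\<And>r \<C>. structure_iso (induced_structure T R F U (ZX (S r))) \<C> \<Longrightarrow>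
        turing_le (atomic_diagram (\<B> r)) (atomic_diagram \<C>)"
    by metis
  show False
  \<comment> \<open>An enumeration of \<open>S r\<close> computes some copy, and by leastness that
    copy computes the diagram of \<open>\<B> r\<close>.\<close>
  proof (rule chain_not_computable_from_all_enumerations[of S "\<lambda>r. atomic_diagram (\<B> r)"])
    show "S r \<subseteq> S r'" if "r \<le> r'" for r r'
      using that by (fastforce simp: S_def)
    have S_neq: "S r \<noteq> S r'" if r: "r < r'" for r r'
    proof -
      obtain q where "r < real_of_rat q" "real_of_rat q < r'"
        using of_rat_dense[OF r] by blast
      moreover have "x (to_nat q) = x k \<longleftrightarrow> to_nat q = k" for k
        using \<open>strict_mono x\<close> by (simp add: strict_mono_eq)
      \<comment> \<open>A rational between \<open>r\<close> and \<open>r'\<close> separates the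
        cuts, and the gap ensures that its marker does not belong to the transversal.\<close>
      ultimately have "Suc (x (to_nat q)) \<in> S r'" "Suc (x (to_nat q)) \<notin> S r"
        using x_gap by (auto simp: S_def)
      then show ?thesis by blast
    qed
    show "inj (\<lambda>r. atomic_diagram (\<B> r))"
    proof (rule injI)
      fix r r' assume eq: "atomic_diagram (\<B> r) = atomic_diagram (\<B> r')"
      have "n \<in> S r \<longleftrightarrow> n \<in> S r'" for n
        using mem_iff_copy[OF S \<B>(1), of n r] mem_iff_copy[OF S \<B>(1), of n r'] eq S[of r] S[of r']
        by (cases "0 < n") auto
      then have "S r = S r'" by blast
      then show "r = r'" using S_neq by (metis linorder_neqE)
    qed
    show "decidable_in {g} (\<lambda>n. n \<in> atomic_diagram (\<B> r))" if g: "enumerates g (S r)" for r g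
    proof -
      obtain \<C> where \<C>: "structure_iso (induced_structure T R F U (ZX (S r))) \<C>"
        "decidable_in {g} (\<lambda>n. n \<in> atomic_diagram \<C>)"
        using copy[OF g] by blast
      show ?thesis
        using \<C>(2) by (intro decidable_in_trans[OF \<B>(2)[OF \<C>(1), unfolded turing_le_iff_decidable]])
          (simp only: decidable_in_def char_fun_of_bool)
    qed
  qed
qed

text \<open>The points of the induced structure itself, unlike those of an arbitrary copy, are
  points of Z, so a single query about \<open>e i\<close> decides between \<open>i\<close> and
  \<open>j\<close>.\<close>

lemma embeddable_decision_program:
  "\<exists>p. \<forall>X i j. X \<subseteq> {0<..} \<and> 0 < i \<longrightarrow>
     rec_eval (char_fun (atomic_diagram (induced_structure T R F U (ZX X)))) p [i, j]
       (if e i \<in> ZX X then i else j)"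
proof -
  obtain p where p: "\<And>g n. 0 < n \<Longrightarrow> rec_eval g p [n] (e n)" using e_program by blast
  \<comment> \<open>Admitting all oracles yields one program that serves every
    \<open>X\<close>.\<close>
  have "computable_in UNIV (\<lambda>x. list_encode [0, x])" by (intro computability)
  then obtain q where q: "\<And>g x. rec_eval g q [x] (list_encode [0, x])"
    by (auto simp: computable_in_def)
  let ?c = "Comp Query [Comp q [Comp p [Proj 0]]]"
  have "rec_eval g (Comp (PrimRec (Proj 1) (Proj 2)) [?c, Proj 0, Proj 1]) [i, j]
      (if e i \<in> ZX X then i else j)"
    if X: "X \<subseteq> {0<..}" "0 < i" and g: "g = char_fun (atomic_diagram (induced_structure T R F U (ZX X)))"
    for X i j g
  proof -
    have "g (list_encode [0, e i]) = of_bool (e i \<in> ZX X)"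
      unfolding g char_fun_of_bool list_encode_mem_atomic_diagram
      by (simp add: induced_structure_simps[OF ZX_subset[OF X(1)]])
    moreover have "rec_eval g ?c [i, j] (g (list_encode [0, e i]))"
      by (rule rec_eval_Comp1[OF rec_eval_Comp1[OF rec_eval_Comp1[OF rec_eval_Proj_0 p[OF X(2)]] q]
          rec_eval.query])
    ultimately have c: "rec_eval g ?c [i, j] (of_bool (e i \<in> ZX X))"
      by (simp only:)
    show ?thesis
    proof (rule rec_eval.comp[of "[of_bool (e i \<in> ZX X), i, j]"])
      show "\<forall>k<length [?c, Proj 0, Proj 1].
          rec_eval g ([?c, Proj 0, Proj 1] ! k) [i, j] ([of_bool (e i \<in> ZX X), i, j] ! k)"
        using c rec_eval.proj[of 0 "[i, j]" g] rec_eval.proj[of 1 "[i, j]" g]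
        by (auto simp: less_Suc_eq)
      show "rec_eval g (PrimRec (Proj 1) (Proj 2)) [of_bool (e i \<in> ZX X), i, j]
          (if e i \<in> ZX X then i else j)"
        using rec_eval_cond[of g "of_bool (e i \<in> ZX X)" i j] by (auto split: if_splits)
    qed simp
  qed
  then show ?thesis by blast
qed

end

theorem theorem5p5:
  fixes T :: "nat topology" and R :: "nat ring" and F :: "nat set \<Rightarrow> nat set"
    and U :: "nat \<Rightarrow> nat set" and A B :: "nat set" and e :: "nat \<Rightarrow> nat"
  defines "Z \<equiv> topspace T"
    and "ZX \<equiv> coded_subset A B e"
  assumes elements: "ringed_space_of_elements T R F"
    and infinite_Z: "infinite Z"
    and opens: "range U = {V. openin T V}"
    and computable_Z: "computable_structure (ambient_structure T R F U)"
    and A_sub: "A \<subseteq> Z"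
    and A_common: "\<And>V. openin T V \<Longrightarrow> V \<noteq> {} \<Longrightarrow> A \<subseteq> V"
    and A_empty: "A = {} \<Longrightarrow> \<not> (\<exists>C. C \<noteq> {} \<and> (\<forall>V. openin T V \<and> V \<noteq> {} \<longrightarrow> C \<subseteq> V))"
    and A_computable: "computable_set A" and A_coinfinite: "infinite (Z - A)"
    and assumption:
      "(\<forall>Y. A \<subseteq> Y \<and> Y \<subseteq> Z \<and> Y \<noteq> {} \<longrightarrow>
           closedin (subtopology T Y) Y \<and> irreducible_space (subtopology T Y)) \<or>
       (\<forall>Y. Y \<subseteq> Z \<and> infinite Y \<longrightarrow> irreducible_space (subtopology T Y))"
    and B_finite_A: "finite A \<Longrightarrow> B \<subseteq> Z - A \<and> computable_set B \<and> infinite (Z - B)"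
    and B_infinite_A: "infinite A \<Longrightarrow> B = {}"
    and e_enum: "bij_betw e {0<..} (Z - (A \<union> B))"
    and e_computable: "computable_fun_on {0<..} e"
    and le_T: "\<And>X. X \<subseteq> {0<..} \<Longrightarrow> turing_le (section_set T R F U (ZX X)) X"
    and le_e: "\<And>X. X \<subseteq> {0<..} \<Longrightarrow> enum_le (section_set T R F U (ZX X)) X"
  shows
    "(\<forall>M N. M \<subseteq> {0<..} \<and> N \<subseteq> {0<..} \<longrightarrow>
        ((\<exists>m. inclusion_morphism T R F (ZX M) (ZX N) m) \<longleftrightarrow> M \<subseteq> N))
     \<and>
     (\<exists>p. \<forall>X i j. X \<subseteq> {0<..} \<and> 0 < i \<and> 0 < j \<and> ZX {i} \<noteq> ZX {j} \<and>
        (embeddable T R F (ZX {i}) (ZX X) \<longleftrightarrow> \<not> embeddable T R F (ZX {j}) (ZX X)) \<longrightarrow>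
        (embeddable T R F (ZX {i}) (ZX X) \<longleftrightarrow> e i \<in> ZX X) \<and>
        (embeddable T R F (ZX {j}) (ZX X) \<longleftrightarrow> e j \<in> ZX X) \<and>
        rec_eval (char_fun (atomic_diagram (induced_structure T R F U (ZX X)))) p [i, j]
          (if embeddable T R F (ZX {i}) (ZX X) then i else j))
     \<and>
     (\<forall>d\<in>turing_degrees. \<exists>\<A>. (\<exists>S\<subseteq>{0<..}. structure_iso (induced_structure T R F U (ZX S)) \<A>)
        \<and> iso_type_has_degree \<A> d)
     \<and>
     (\<exists>\<A>. (\<exists>S\<subseteq>{0<..}. structure_iso (induced_structure T R F U (ZX S)) \<A>)
        \<and> \<not> (\<exists>d\<in>turing_degrees. iso_type_has_degree \<A> d))"
proof -
  have B: "B \<subseteq> Z" "computable_set B"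
  proof -
    have "computable_set {}"
      by (auto simp: computable_set_def char_fun_def intro!: exI[of _ Zero] rec_eval.zero)
    then show "B \<subseteq> Z" "computable_set B"
      using B_finite_A B_infinite_A by (cases "finite A"; auto)+
  qed
  interpret coded_ringed_space T R F U A B e
    by unfold_locales
      (use elements opens computable_Z A_sub A_common A_empty A_computable B e_enum e_computable
        le_T le_e in \<open>simp_all add: Z_def ZX_def\<close>)
  \<comment> \<open>Both coded sets contain \<open>A \<union> B\<close>, so only the point
    \<open>e i\<close> is at stake.\<close>
  have emb: "embeddable T R F (ZX {i}) (ZX X) \<longleftrightarrow> e i \<in> ZX X" if "X \<subseteq> {0<..}" "0 < i" for X i
    using embeddable_iff_subset[OF R.ring_axioms ZX_subset[of "{i}"] ZX_subset[of X]]
      ZX_subset_ZX_iff[of "{i}" X] e_mem_ZX_iff[of X i] that by (simp add: ZX_def)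
  show ?thesis
  proof (intro conjI allI ballI impI)
    fix M N :: "nat set" assume "M \<subseteq> {0<..} \<and> N \<subseteq> {0<..}"
    then show "(\<exists>m. inclusion_morphism T R F (ZX M) (ZX N) m) \<longleftrightarrow> M \<subseteq> N"
      using inclusion_morphism_imp_subset inclusion_map_morphism[OF R.ring_axioms]
        ZX_subset ZX_subset_ZX_iff unfolding ZX_def by metis
  next
    obtain p where p: "\<forall>X i j. X \<subseteq> {0<..} \<and> 0 < i \<longrightarrow>
       rec_eval (char_fun (atomic_diagram (induced_structure T R F U (ZX X)))) p [i, j]
         (if e i \<in> ZX X then i else j)"
      using embeddable_decision_program unfolding ZX_def by blast
    show "\<exists>p. \<forall>X i j. X \<subseteq> {0<..} \<and> 0 < i \<and> 0 < j \<and> ZX {i} \<noteq> ZX {j} \<and>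
        (embeddable T R F (ZX {i}) (ZX X) \<longleftrightarrow> \<not> embeddable T R F (ZX {j}) (ZX X)) \<longrightarrow>
        (embeddable T R F (ZX {i}) (ZX X) \<longleftrightarrow> e i \<in> ZX X) \<and>
        (embeddable T R F (ZX {j}) (ZX X) \<longleftrightarrow> e j \<in> ZX X) \<and>
        rec_eval (char_fun (atomic_diagram (induced_structure T R F U (ZX X)))) p [i, j]
          (if embeddable T R F (ZX {i}) (ZX X) then i else j)"
    proof (rule exI[of _ p], intro allI impI)
      fix X i j
      assume "X \<subseteq> {0<..} \<and> 0 < i \<and> 0 < j \<and> ZX {i} \<noteq> ZX {j} \<and>
        (embeddable T R F (ZX {i}) (ZX X) \<longleftrightarrow> \<not> embeddable T R F (ZX {j}) (ZX X))"
      then have X: "X \<subseteq> {0<..}" "0 < i" "0 < j" by auto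
      show "(embeddable T R F (ZX {i}) (ZX X) \<longleftrightarrow> e i \<in> ZX X) \<and>
        (embeddable T R F (ZX {j}) (ZX X) \<longleftrightarrow> e j \<in> ZX X) \<and>
        rec_eval (char_fun (atomic_diagram (induced_structure T R F U (ZX X)))) p [i, j]
          (if embeddable T R F (ZX {i}) (ZX X) then i else j)"
        unfolding emb[OF X(1,2)] emb[OF X(1,3)] using p X by blast
    qed
  next
    fix d assume "d \<in> turing_degrees"
    then obtain X where "d = turing_degree X" by (auto simp: turing_degrees_def)
    then show "\<exists>\<A>. (\<exists>S\<subseteq>{0<..}. structure_iso (induced_structure T R F U (ZX S)) \<A>)
        \<and> iso_type_has_degree \<A> d"
      using ex_iso_type_has_degree[of X] structure_iso_refl unfolding ZX_def by blast
  next
    show "\<exists>\<A>. (\<exists>S\<subseteq>{0<..}. structure_iso (induced_structure T R F U (ZX S)) \<A>)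
        \<and> \<not> (\<exists>d\<in>turing_degrees. iso_type_has_degree \<A> d)"
      using ex_iso_type_no_degree structure_iso_refl unfolding ZX_def by blast
  qed
qed

end
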